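(* Let $k\ge 1$ and let $G_k$ be the group of reparametrizations of $k$-jets of holomorphic curves. Let $T_k$ be a maximal torus of $G_k$ and $W_k=N_{G_k}(T_k)/T_k$ the associated Weyl group. Then the representation ring of $G_k$ satisfies $R(G_k)=R(T_k)^{W_k}$.
   Context: $G_k\subset GL_k(\mathbb{C})$ is the complex algebraic group of all upper triangular $k\times k$ matrices $A(a_1,\dots,a_k)$, $a_1\in\mathbb{C}^*$, $a_2,\dots,a_k\in\mathbb{C}$, with entries $A_{ij}=\sum_{s_1+\cdots+s_i=j,\ s_l\ge 1} a_{s_1}\cdots a_{s_i}$. It corresponds to the group of reparametrizations $t\mapsto a_1t+a_2t^2+\cdots+a_kt^k$ modulo $t^{k+1}$. The representation ring $R(G)=\bigoplus\mathbb{Z}[\rho]$ is the Grothendieck ring of finite-dimensional algebraic $G$-modules: the free abelian group on the classes of irreducible representations $\rho$ of $G$, with product induced by tensor product. Via characters it is viewed as a ring of class functions on $G$. The Weyl group $W_k$ acts naturally on $R(T_k)$, and the equality $R(G_k)=R(T_k)^{W_k}$ means that restriction of class functions from $G_k$ to $T_k$ identifies $R(G_k)$ with the ring of $W_k$-invariants in $R(T_k)$. *)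

theory Defs
  imports
    "Jordan_Normal_Form.Matrix"
    "Jordan_Normal_Form.Determinant"
    "Jordan_Normal_Form.Matrix_Kernel"
    "HOL-Algebra.Free_Abelian_Groups"
    "HOL-Algebra.QuotRing"
    "HOL-Algebra.Group_Action"
begin

section \<open>Linear algebraic groups over the complex numbers\<close>

definition GL :: "nat \<Rightarrow> complex mat monoid" where
  "GL n = units_of (ring_mat TYPE(complex) n ())"

text \<open>A linear group is given by its degree \<open>n\<close> and its underlying set \<open>H\<close> of invertible
  \<open>n \<times> n\<close> matrices.\<close>

abbreviation mat_group :: "nat \<Rightarrow> complex mat set \<Rightarrow> complex mat monoid" where
  "mat_group n H \<equiv> (GL n)\<lparr>carrier := H\<rparr>"

text \<open>The coordinate ring of \<open>GL n\<close>, that is \<open>\<complex>[x\<^sub>i\<^sub>j, 1/det]\<close>, realised as a ring of functions.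
  Only the values on invertible \<open>n \<times> n\<close> matrices matter.\<close>

inductive_set regular_functions :: "nat \<Rightarrow> (complex mat \<Rightarrow> complex) set" for n :: nat where
  const: "(\<lambda>A. c) \<in> regular_functions n"
| entry: "i < n \<Longrightarrow> j < n \<Longrightarrow> (\<lambda>A. A $$ (i, j)) \<in> regular_functions n"
| inv_det: "(\<lambda>A. inverse (det A)) \<in> regular_functions n"
| add: "f \<in> regular_functions n \<Longrightarrow> g \<in> regular_functions n \<Longrightarrow>
    (\<lambda>A. f A + g A) \<in> regular_functions n"
| mult: "f \<in> regular_functions n \<Longrightarrow> g \<in> regular_functions n \<Longrightarrow>
    (\<lambda>A. f A * g A) \<in> regular_functions n"

definition regular_on :: "nat \<Rightarrow> complex mat set \<Rightarrow> (complex mat \<Rightarrow> complex) \<Rightarrow> bool" where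
  "regular_on n H f \<longleftrightarrow> (\<exists>g \<in> regular_functions n. \<forall>A \<in> H. f A = g A)"

definition algebraic_group :: "nat \<Rightarrow> complex mat set \<Rightarrow> bool" where
  "algebraic_group n H \<longleftrightarrow> subgroup H (GL n) \<and>
     (\<exists>S \<subseteq> regular_functions n. H = {A \<in> carrier (GL n). \<forall>f \<in> S. f A = 0})"

text \<open>Morphisms of algebraic groups. Regularity of the inverse determinant of \<open>\<phi>\<close> need not be
  demanded: it is the determinant of \<open>\<phi> (inv A)\<close>.\<close>

definition algebraic_hom ::
    "nat \<Rightarrow> complex mat set \<Rightarrow> nat \<Rightarrow> complex mat set \<Rightarrow> (complex mat \<Rightarrow> complex mat) set" where
  "algebraic_hom n H m K = {\<phi> \<in> hom (mat_group n H) (mat_group m K).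
     \<forall>i < m. \<forall>j < m. regular_on n H (\<lambda>A. \<phi> A $$ (i, j))}"

definition algebraic_isomorphic ::
    "nat \<Rightarrow> complex mat set \<Rightarrow> nat \<Rightarrow> complex mat set \<Rightarrow> bool" where
  "algebraic_isomorphic n H m K \<longleftrightarrow>
     (\<exists>\<phi> \<in> algebraic_hom n H m K. \<exists>\<psi> \<in> algebraic_hom m K n H.
        (\<forall>A \<in> H. \<psi> (\<phi> A) = A) \<and> (\<forall>B \<in> K. \<phi> (\<psi> B) = B))"

text \<open>The standard torus \<open>(\<complex>\<^sup>*)\<^sup>r\<close>, realised by diagonal matrices; \<open>r = 0\<close> is the trivial group.\<close>

definition diagonal_torus :: "nat \<Rightarrow> complex mat set" where
  "diagonal_torus r = {A \<in> carrier (GL r). diagonal_mat A}"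

definition torus :: "nat \<Rightarrow> complex mat set \<Rightarrow> bool" where
  "torus n T \<longleftrightarrow> algebraic_group n T \<and> (\<exists>r. algebraic_isomorphic n T r (diagonal_torus r))"

definition maximal_torus :: "nat \<Rightarrow> complex mat set \<Rightarrow> complex mat set \<Rightarrow> bool" where
  "maximal_torus n G T \<longleftrightarrow> torus n T \<and> T \<subseteq> G \<and>
     (\<forall>T'. torus n T' \<and> T \<subseteq> T' \<and> T' \<subseteq> G \<longrightarrow> T' = T)"

section \<open>Finite-dimensional algebraic modules\<close>

text \<open>A pair \<open>(d, \<rho>)\<close> stands for the module \<open>\<complex>\<^sup>d\<close> on which \<open>g\<close> acts by the matrix \<open>\<rho> g\<close>. Every
  finite-dimensional module is isomorphic to one of these.\<close>

type_synonym rep = "nat \<times> (complex mat \<Rightarrow> complex mat)"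

definition algebraic_reps :: "nat \<Rightarrow> complex mat set \<Rightarrow> rep set" where
  "algebraic_reps n H = {(d, \<rho>). \<rho> \<in> algebraic_hom n H d (carrier (GL d))}"

definition module_homs :: "complex mat set \<Rightarrow> rep \<Rightarrow> rep \<Rightarrow> complex mat set" where
  "module_homs H V W = {F \<in> carrier_mat (fst W) (fst V). \<forall>g \<in> H. F * snd V g = snd W g * F}"

text \<open>There is a short exact sequence of modules \<open>0 \<rightarrow> U \<rightarrow> V \<rightarrow> W \<rightarrow> 0\<close>.\<close>

definition short_exact :: "complex mat set \<Rightarrow> rep \<Rightarrow> rep \<Rightarrow> rep \<Rightarrow> bool" where
  "short_exact H U V W \<longleftrightarrow> (\<exists>I \<in> module_homs H U V. \<exists>P \<in> module_homs H V W.
     inj_on (\<lambda>u. I *\<^sub>v u) (carrier_vec (fst U)) \<and>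
     (\<lambda>u. I *\<^sub>v u) ` carrier_vec (fst U) = mat_kernel P \<and>
     (\<lambda>v. P *\<^sub>v v) ` carrier_vec (fst V) = carrier_vec (fst W))"

definition kronecker :: "complex mat \<Rightarrow> complex mat \<Rightarrow> complex mat" where
  "kronecker A B = mat (dim_row A * dim_row B) (dim_col A * dim_col B)
     (\<lambda>(i, j). A $$ (i div dim_row B, j div dim_col B) * B $$ (i mod dim_row B, j mod dim_col B))"

definition tensor_rep :: "rep \<Rightarrow> rep \<Rightarrow> rep" where
  "tensor_rep V W = (fst V * fst W, \<lambda>g. kronecker (snd V g) (snd W g))"

definition trivial_rep :: rep where
  "trivial_rep = (1, \<lambda>g. 1\<^sub>m 1)"

section \<open>The representation ring\<close>

text \<open>The free abelian group on all modules, multiplied by the bilinear extension of the tensor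
  product.\<close>

definition free_rep_ring :: "nat \<Rightarrow> complex mat set \<Rightarrow> (rep \<Rightarrow>\<^sub>0 int) ring" where
  "free_rep_ring n H =
     \<lparr>carrier = carrier (free_Abelian_group (algebraic_reps n H)),
      monoid.mult = (\<lambda>x y. frag_extend (\<lambda>V. frag_extend (\<lambda>W. frag_of (tensor_rep V W)) y) x),
      monoid.one = frag_of trivial_rep,
      ring.zero = 0,
      ring.add = (+)\<rparr>"

definition exact_relations :: "nat \<Rightarrow> complex mat set \<Rightarrow> (rep \<Rightarrow>\<^sub>0 int) set" where
  "exact_relations n H = generate (add_monoid (free_rep_ring n H))
     {frag_of V - (frag_of U + frag_of W) | U V W.
        U \<in> algebraic_reps n H \<and> V \<in> algebraic_reps n H \<and> W \<in> algebraic_reps n H \<and>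
        short_exact H U V W}"

text \<open>The Grothendieck ring. By the Jordan--Hoelder theorem its additive group is free on the
  classes of the irreducible modules. Since the tensor product is exact, the additive subgroup
  \<^const>\<open>exact_relations\<close> is an ideal.\<close>

definition rep_ring :: "nat \<Rightarrow> complex mat set \<Rightarrow> (rep \<Rightarrow>\<^sub>0 int) set ring" where
  "rep_ring n H = free_rep_ring n H Quot exact_relations n H"

section \<open>Class functions and characters\<close>

definition class_function_ring :: "nat \<Rightarrow> complex mat set \<Rightarrow> (complex mat \<Rightarrow> complex) ring" where
  "class_function_ring n H =
     \<lparr>carrier = {f \<in> extensional H. \<forall>g \<in> H. \<forall>h \<in> H.
        f (h \<otimes>\<^bsub>mat_group n H\<^esub> g \<otimes>\<^bsub>mat_group n H\<^esub> inv\<^bsub>mat_group n H\<^esub> h) = f g},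
      monoid.mult = (\<lambda>f f'. \<lambda>g\<in>H. f g * f' g),
      monoid.one = (\<lambda>g\<in>H. 1),
      ring.zero = (\<lambda>g\<in>H. 0),
      ring.add = (\<lambda>f f'. \<lambda>g\<in>H. f g + f' g)\<rparr>"

definition mat_trace :: "complex mat \<Rightarrow> complex" where
  "mat_trace A = (\<Sum>i < dim_row A. A $$ (i, i))"

definition virtual_character :: "complex mat set \<Rightarrow> (rep \<Rightarrow>\<^sub>0 int) \<Rightarrow> complex mat \<Rightarrow> complex" where
  "virtual_character H x =
     (\<lambda>g\<in>H. \<Sum>V \<in> Poly_Mapping.keys x. of_int (Poly_Mapping.lookup x V) * mat_trace (snd V g))"

text \<open>Traces are additive on short exact sequences, so all members of a class in the Grothendieck
  ring have the same virtual character.\<close>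

definition character :: "complex mat set \<Rightarrow> (rep \<Rightarrow>\<^sub>0 int) set \<Rightarrow> complex mat \<Rightarrow> complex" where
  "character H X = the_elem (virtual_character H ` X)"

text \<open>The representation ring viewed as a ring of class functions.\<close>

definition character_ring :: "nat \<Rightarrow> complex mat set \<Rightarrow> (complex mat \<Rightarrow> complex) ring" where
  "character_ring n H = (class_function_ring n H)\<lparr>carrier := character H ` carrier (rep_ring n H)\<rparr>"

section \<open>The Weyl group\<close>

definition weyl_group :: "nat \<Rightarrow> complex mat set \<Rightarrow> complex mat set \<Rightarrow> complex mat set monoid" where
  "weyl_group n G T = mat_group n (normalizer (mat_group n G) T) Mod T"

text \<open>The coset of \<open>w\<close> acts by \<open>f \<mapsto> (t \<mapsto> f (w\<inverse> t w))\<close>; this is independent of the chosen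
  representative because \<open>T\<close> is commutative.\<close>

definition weyl_action ::
    "nat \<Rightarrow> complex mat set \<Rightarrow> complex mat set \<Rightarrow> (complex mat \<Rightarrow> complex) \<Rightarrow> complex mat \<Rightarrow> complex"
  where
  "weyl_action n T w f =
     the_elem ((\<lambda>a. \<lambda>t\<in>T. f (inv\<^bsub>GL n\<^esub> a \<otimes>\<^bsub>GL n\<^esub> t \<otimes>\<^bsub>GL n\<^esub> a)) ` w)"

definition weyl_invariant_ring ::
    "nat \<Rightarrow> complex mat set \<Rightarrow> complex mat set \<Rightarrow> (complex mat \<Rightarrow> complex) ring" where
  "weyl_invariant_ring n G T = (character_ring n T)\<lparr>carrier :=
     {f \<in> carrier (character_ring n T). \<forall>w \<in> carrier (weyl_group n G T). weyl_action n T w f = f}\<rparr>"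

section \<open>Reparametrizations of jets\<close>

text \<open>The sum runs over all \<open>(s\<^sub>1, \<dots>, s\<^sub>i)\<close> with positive entries and sum \<open>j\<close>; it is the coefficient
  of \<open>t\<^sup>j\<close> in \<open>(a\<^sub>1 t + a\<^sub>2 t\<^sup>2 + \<dots>)\<^sup>i\<close>. Matrices are indexed from \<open>0\<close>, hence the shift.\<close>

definition reparam_mat :: "nat \<Rightarrow> (nat \<Rightarrow> complex) \<Rightarrow> complex mat" where
  "reparam_mat k a = mat k k (\<lambda>(i, j).
     \<Sum>s | length s = i + 1 \<and> sum_list s = j + 1 \<and> (\<forall>m \<in> set s. 1 \<le> m). prod_list (map a s))"

definition reparam_group :: "nat \<Rightarrow> complex mat set" where
  "reparam_group k = {reparam_mat k a | a. a 1 \<noteq> 0}"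

end

theory Submission
  imports
    Defs
    "HOL-Computational_Algebra.Formal_Power_Series"
    "HOL-Algebra.Zassenhaus"
begin

text \<open>Reading off the linear coefficient \<open>a\<^sub>1\<close> is a character \<open>\<chi>\<close> of \<open>G\<^sub>k\<close>, and conjugation by the
  scalings \<open>t \<mapsto> b t\<close> contracts every \<open>g\<close> to the scaling by \<open>\<chi> g\<close> as \<open>b\<close> tends to \<open>0\<close>. Hence the
  lowest weight vectors of a module under the scalings are common eigenvectors of \<open>G\<^sub>k\<close>, every class
  in \<open>R(G\<^sub>k)\<close> is an integral combination of powers of \<open>\<chi>\<close>, and characters are Laurent polynomials in
  \<open>\<chi>\<close>. A maximal torus \<open>T\<close> is nontrivial, and \<open>\<chi>\<close> is injective on its elements of finite order
  because unipotent elements of finite order are trivial; so \<open>\<chi>\<close> is an isomorphism \<open>T \<cong> \<complex>\<^sup>*\<close> and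
  \<open>R(T)\<close> consists of the same Laurent polynomials. They are all invariant under the Weyl group since
  \<open>\<chi>\<close> is a class function on \<open>G\<^sub>k\<close>.\<close>

section \<open>The general linear group and regular functions\<close>

text \<open>The limit \<open>b\<close> to \<open>0\<close> is purely algebraic: the conjugate of
  \<open>g\<close> by the scaling \<open>b\<close> depends polynomially on \<open>b\<close>, the
  value at \<open>0\<close> included, and polynomials that agree off \<open>0\<close> agree at
  \<open>0\<close>. If \<open>R a\<close> is the action of the scaling \<open>a\<close> on a module,
  then \<open>R a = a^m P a\<close> with \<open>P\<close> polynomial and \<open>P 0\<close> nonzero.
  The relation \<open>g * \<tau> b = \<tau> b * M b\<close> becomes
  \<open>\<rho> g * P b = P b * \<rho> (M b)\<close> after cancelling \<open>b^m\<close>. At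
  \<open>b = 0\<close> the right side is \<open>P 0\<close> times the action of a scaling, hence a
  multiple of \<open>P 0\<close>, and every nonzero column of \<open>P 0\<close> is a common
  eigenvector. The obstacle is that \<open>T\<close> is an arbitrary maximal torus and not the group
  of scalings. Therefore \<open>G_k\<close> and \<open>T\<close> are treated as two instances of one
  locale, which describes both character rings by the same finitely supported exponents
  \<open>c\<close>. For \<open>T\<close> the contraction is the constant family, because
  \<open>T\<close> is commutative and covered by a section of the character. Maximality enters
  through a comparison with the torus of scalings, which excludes the trivial torus.\<close>

lemma mult_GL [simp]: "monoid.mult (GL n) = (*)"
  and one_GL [simp]: "monoid.one (GL n) = 1\<^sub>m n"
  by (simp_all add: GL_def units_of_def ring_mat_simps)

lemma carrier_GL_iff: "A \<in> carrier (GL n) \<longleftrightarrow> A \<in> carrier_mat n n \<and> det A \<noteq> 0"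
proof
  assume "A \<in> carrier (GL n)"
  then have A: "A \<in> Units (ring_mat TYPE(complex) n ())"
    by (simp add: GL_def units_of_def)
  moreover from A have "A \<in> carrier_mat n n"
    by (auto simp: Units_def ring_mat_simps)
  ultimately show "A \<in> carrier_mat n n \<and> det A \<noteq> 0"
    using unit_imp_det_non_zero[OF A] by simp
qed (auto simp: GL_def units_of_def intro: det_non_zero_imp_unit)

lemma group_GL: "group (GL n)"
proof -
  interpret semiring "ring_mat TYPE(complex) n ()" by (rule semiring_mat)
  show ?thesis unfolding GL_def by (rule units_group)
qed

text \<open>The transfer from regular functions of a matrix to functions of a parameter, along a
  family \<open>\<gamma>\<close>. It is applied with \<open>F\<close> the polynomial or the Laurent
  polynomial functions.\<close>

lemma regular_functions_comp:
  assumes "f \<in> regular_functions n"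
    and "\<And>c. F (\<lambda>_. c)"
    and "\<And>u v. F u \<Longrightarrow> F v \<Longrightarrow> F (\<lambda>x. u x + v x)"
    and "\<And>u v. F u \<Longrightarrow> F v \<Longrightarrow> F (\<lambda>x. u x * v x)"
    and "\<And>i j. i < n \<Longrightarrow> j < n \<Longrightarrow> F (\<lambda>x. \<gamma> x $$ (i, j))"
    and "F (\<lambda>x. inverse (det (\<gamma> x)))"
  shows "F (\<lambda>x. f (\<gamma> x))"
  using assms(1) by induction (use assms(2-) in auto)

section \<open>Closure properties of regular functions on a set of matrices\<close>

lemma regular_on_const: "regular_on n H (\<lambda>_. c)"
  unfolding regular_on_def by (rule bexI[OF _ regular_functions.const[of c]]) simp

lemma regular_on_entry: "i < n \<Longrightarrow> j < n \<Longrightarrow> regular_on n H (\<lambda>A. A $$ (i, j))"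
  unfolding regular_on_def by (rule bexI[OF _ regular_functions.entry[of i n j]]) simp_all

lemma regular_on_inv_det: "regular_on n H (\<lambda>A. inverse (det A))"
  unfolding regular_on_def by (rule bexI[OF _ regular_functions.inv_det]) simp

lemma regular_on_add:
  assumes "regular_on n H f" "regular_on n H g"
  shows "regular_on n H (\<lambda>A. f A + g A)"
proof -
  obtain f' g' where "f' \<in> regular_functions n" "\<forall>A\<in>H. f A = f' A"
    "g' \<in> regular_functions n" "\<forall>A\<in>H. g A = g' A"
    using assms by (auto simp: regular_on_def)
  then show ?thesis
    unfolding regular_on_def by (intro bexI[OF _ regular_functions.add[of f' n g']]) auto
qed

lemma regular_on_mult:
  assumes "regular_on n H f" "regular_on n H g"
  shows "regular_on n H (\<lambda>A. f A * g A)"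
proof -
  obtain f' g' where "f' \<in> regular_functions n" "\<forall>A\<in>H. f A = f' A"
    "g' \<in> regular_functions n" "\<forall>A\<in>H. g A = g' A"
    using assms by (auto simp: regular_on_def)
  then show ?thesis
    unfolding regular_on_def by (intro bexI[OF _ regular_functions.mult[of f' n g']]) auto
qed

lemma regular_on_sum:
  "(\<And>i. i \<in> I \<Longrightarrow> regular_on n H (f i)) \<Longrightarrow> regular_on n H (\<lambda>A. \<Sum>i\<in>I. f i A)"
  by (induction I rule: infinite_finite_induct) (simp_all add: regular_on_const regular_on_add)

lemma regular_on_prod:
  "(\<And>i. i \<in> I \<Longrightarrow> regular_on n H (f i)) \<Longrightarrow> regular_on n H (\<lambda>A. \<Prod>i\<in>I. f i A)"
  by (induction I rule: infinite_finite_induct) (simp_all add: regular_on_const regular_on_mult)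

lemma regular_on_power: "regular_on n H f \<Longrightarrow> regular_on n H (\<lambda>A. f A ^ m)"
  by (induction m) (simp_all add: regular_on_const regular_on_mult)

lemma regular_on_cong:
  "regular_on n H f \<Longrightarrow> (\<And>A. A \<in> H \<Longrightarrow> f A = g A) \<Longrightarrow> regular_on n H g"
  unfolding regular_on_def by fastforce

lemma smult_smult_mat: "c \<cdot>\<^sub>m (e \<cdot>\<^sub>m A) = (c * e) \<cdot>\<^sub>m (A :: 'a::semigroup_mult mat)"
  by (rule eq_matI) (auto simp: mult.assoc)

lemma one_smult_mat: "(1::'a::monoid_mult) \<cdot>\<^sub>m A = A"
  by (rule eq_matI) auto

section \<open>Polynomial and Laurent polynomial functions\<close>

definition polyfun :: "(complex \<Rightarrow> complex) \<Rightarrow> bool" where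
  "polyfun f \<longleftrightarrow> (\<exists>p. \<forall>x. f x = poly p x)"

text \<open>Nothing is demanded at \<open>0\<close>, where the families in question leave the group.
  In contrast \<open>polyfun\<close> fixes the value at \<open>0\<close>, which is where limits are
  read off.\<close>

definition laurentfun :: "(complex \<Rightarrow> complex) \<Rightarrow> bool" where
  "laurentfun f \<longleftrightarrow> (\<exists>p m. \<forall>x. x \<noteq> 0 \<longrightarrow> f x = poly p x / x ^ m)"

lemma polyfun_const: "polyfun (\<lambda>_. c)"
  unfolding polyfun_def by (rule exI[of _ "[:c:]"]) simp

lemma polyfun_id: "polyfun (\<lambda>x. x)"
  unfolding polyfun_def by (rule exI[of _ "[:0, 1:]"]) simp

lemma polyfun_add: "polyfun f \<Longrightarrow> polyfun g \<Longrightarrow> polyfun (\<lambda>x. f x + g x)"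
  unfolding polyfun_def by (metis poly_add)

lemma polyfun_mult: "polyfun f \<Longrightarrow> polyfun g \<Longrightarrow> polyfun (\<lambda>x. f x * g x)"
  unfolding polyfun_def by (metis poly_mult)

lemma polyfun_power: "polyfun f \<Longrightarrow> polyfun (\<lambda>x. f x ^ m)"
  unfolding polyfun_def by (metis poly_power)

lemma polyfun_sum: "(\<And>i. i \<in> I \<Longrightarrow> polyfun (f i)) \<Longrightarrow> polyfun (\<lambda>x. \<Sum>i\<in>I. f i x)"
  by (induction I rule: infinite_finite_induct) (simp_all add: polyfun_const polyfun_add)

lemma polyfun_scale: "polyfun f \<Longrightarrow> polyfun (\<lambda>x. f (c * x))"
  unfolding polyfun_def
proof (elim exE)
  fix p assume "\<forall>x. f x = poly p x"
  then show "\<exists>p. \<forall>x. f (c * x) = poly p x"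
    by (intro exI[of _ "pcompose p [:0, c:]"]) (simp add: poly_pcompose mult.commute)
qed

text \<open>This stands in for a limit as \<open>x\<close> tends to \<open>0\<close>: the difference
  of the two polynomials has infinitely many roots.\<close>

lemma polyfun_eq_at_0:
  assumes "polyfun f" "polyfun g" and eq: "\<And>x. x \<noteq> 0 \<Longrightarrow> f x = g x"
  shows "f 0 = g 0"
proof -
  obtain p q where p: "\<And>x. f x = poly p x" and q: "\<And>x. g x = poly q x"
    using assms(1,2) by (auto simp: polyfun_def)
  have "infinite {x. poly (p - q) x = 0}"
  proof
    assume "finite {x. poly (p - q) x = 0}"
    moreover have "UNIV - {0} \<subseteq> {x. poly (p - q) x = 0}"
      using eq p q by auto
    ultimately show False
      using infinite_UNIV_char_0[where 'a = complex] finite_subset[of "UNIV - {0::complex}"] by auto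
  qed
  then have "p - q = 0"
    using poly_roots_finite by blast
  with p q show ?thesis by simp
qed

lemma laurentfun_cong:
  "laurentfun f \<Longrightarrow> (\<And>x. x \<noteq> 0 \<Longrightarrow> f x = g x) \<Longrightarrow> laurentfun g"
  unfolding laurentfun_def by metis

lemma polyfun_imp_laurentfun: "polyfun f \<Longrightarrow> laurentfun f"
  unfolding polyfun_def laurentfun_def by (metis div_by_1 power_0)

lemma laurentfun_inverse_power: "laurentfun (\<lambda>x. inverse (x ^ m))"
  unfolding laurentfun_def by (rule exI[of _ 1], rule exI[of _ m]) (simp add: field_simps)

lemma laurentfun_add:
  assumes "laurentfun f" "laurentfun g"
  shows "laurentfun (\<lambda>x. f x + g x)"
proof -
  obtain p m q l where f: "\<And>x. x \<noteq> 0 \<Longrightarrow> f x = poly p x / x ^ m"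
    and g: "\<And>x. x \<noteq> 0 \<Longrightarrow> g x = poly q x / x ^ l"
    using assms by (auto simp: laurentfun_def)
  have "f x + g x = poly (p * monom 1 l + q * monom 1 m) x / x ^ (m + l)" if "x \<noteq> 0" for x
    using that by (simp add: f g poly_monom field_simps power_add)
  then show ?thesis unfolding laurentfun_def by blast
qed

lemma laurentfun_mult:
  assumes "laurentfun f" "laurentfun g"
  shows "laurentfun (\<lambda>x. f x * g x)"
proof -
  obtain p m q l where f: "\<And>x. x \<noteq> 0 \<Longrightarrow> f x = poly p x / x ^ m"
    and g: "\<And>x. x \<noteq> 0 \<Longrightarrow> g x = poly q x / x ^ l"
    using assms by (auto simp: laurentfun_def)
  have "f x * g x = poly (p * q) x / x ^ (m + l)" if "x \<noteq> 0" for x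
    using that by (simp add: f g field_simps power_add)
  then show ?thesis unfolding laurentfun_def by blast
qed

text \<open>Needed because the coordinate of a torus may turn out to be the inverse of the
  character.\<close>

lemma laurentfun_inverse_arg:
  assumes "laurentfun f"
  shows "laurentfun (\<lambda>x. f (inverse x))"
proof -
  obtain p m where f: "\<And>x. x \<noteq> 0 \<Longrightarrow> f x = poly p x / x ^ m"
    using assms by (auto simp: laurentfun_def)
  have "laurentfun (\<lambda>x. poly p (inverse x))"
  proof (induction p)
    case 0
    show ?case using polyfun_imp_laurentfun[OF polyfun_const] by simp
  next
    case (pCons a p)
    then show ?case
      using laurentfun_add[OF polyfun_imp_laurentfun[OF polyfun_const]
          laurentfun_mult[OF laurentfun_inverse_power[of 1] pCons(2)]]
      by simp
  qed
  then have "laurentfun (\<lambda>x. poly p (inverse x) * x ^ m)"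
    by (rule laurentfun_mult[OF _ polyfun_imp_laurentfun[OF polyfun_power[OF polyfun_id]]])
  then show ?thesis
    by (rule laurentfun_cong) (simp add: f field_simps)
qed

lemma laurentfun_regular:
  assumes "f \<in> regular_functions n"
    and "\<And>i j. i < n \<Longrightarrow> j < n \<Longrightarrow> laurentfun (\<lambda>x. \<gamma> x $$ (i, j))"
    and "laurentfun (\<lambda>x. inverse (det (\<gamma> x)))"
  shows "laurentfun (\<lambda>x. f (\<gamma> x))"
  by (rule regular_functions_comp[OF assms(1)])
    (use assms in \<open>auto intro: laurentfun_add laurentfun_mult polyfun_imp_laurentfun polyfun_const\<close>)

text \<open>The lowest term of a representation of \<open>\<complex>\<^sup>*\<close>: it exhibits the lowest weight \<open>m\<close>, and
  \<open>P 0\<close> is the projection onto its weight space.\<close>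

lemma lowest_weight:
  fixes R :: "complex \<Rightarrow> complex mat"
  assumes "0 < d"
    and carr: "\<And>a. a \<noteq> 0 \<Longrightarrow> R a \<in> carrier_mat d d"
    and one: "R 1 = 1\<^sub>m d"
    and mult: "\<And>a b. a \<noteq> 0 \<Longrightarrow> b \<noteq> 0 \<Longrightarrow> R (a * b) = R a * R b"
    and laurent: "\<And>i j. i < d \<Longrightarrow> j < d \<Longrightarrow> laurentfun (\<lambda>a. R a $$ (i, j))"
  obtains m :: int and P where
    "\<And>a. P a \<in> carrier_mat d d"
    "\<And>i j. i < d \<Longrightarrow> j < d \<Longrightarrow> polyfun (\<lambda>a. P a $$ (i, j))"
    "\<And>a. a \<noteq> 0 \<Longrightarrow> R a = (a powi m) \<cdot>\<^sub>m P a"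
    "P 0 \<noteq> 0\<^sub>m d d"
    "\<And>a. a \<noteq> 0 \<Longrightarrow> R a * P 0 = (a powi m) \<cdot>\<^sub>m P 0"
    "\<And>a. a \<noteq> 0 \<Longrightarrow> P 0 * R a = (a powi m) \<cdot>\<^sub>m P 0"
proof -
  have "\<forall>i j. \<exists>p l. i < d \<longrightarrow> j < d \<longrightarrow> (\<forall>a. a \<noteq> 0 \<longrightarrow> R a $$ (i, j) = poly p a / a ^ l)"
    using laurent unfolding laurentfun_def by blast
  then obtain p l where pl: "\<And>i j a. i < d \<Longrightarrow> j < d \<Longrightarrow> a \<noteq> 0 \<Longrightarrow>
      R a $$ (i, j) = poly (p i j) a / a ^ l i j"
    by metis
  \<comment> \<open>The sum of all pole orders is one exponent that serves every entry as a common
    denominator.\<close>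
  define N where "N = (\<Sum>i<d. \<Sum>j<d. l i j)"
  have le: "l i j \<le> N" if "i < d" "j < d" for i j
  proof -
    have "l i j \<le> (\<Sum>j<d. l i j)" using that by (intro member_le_sum) auto
    also have "\<dots> \<le> N" unfolding N_def using that
      by (intro member_le_sum[of i "{..<d}" "\<lambda>i. \<Sum>j<d. l i j"]) auto
    finally show ?thesis .
  qed
  define q where "q i j = p i j * monom 1 (N - l i j)" for i j
  have q: "R a $$ (i, j) = poly (q i j) a / a ^ N" if "i < d" "j < d" "a \<noteq> 0" for i j a
  proof -
    have "a ^ N = a ^ (N - l i j) * a ^ l i j"
      using le[OF that(1,2)] by (metis le_add_diff_inverse2 power_add)
    then show ?thesis using that by (simp add: pl q_def poly_monom)
  qed
  have "\<exists>s. \<exists>i<d. \<exists>j<d. coeff (q i j) s \<noteq> 0"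
  proof -
    have "poly (q 0 0) 1 \<noteq> 0" using q[of 0 0 1] one \<open>0 < d\<close> by auto
    then have "q 0 0 \<noteq> 0" by auto
    then show ?thesis using \<open>0 < d\<close> leading_coeff_neq_0 by blast
  qed
  \<comment> \<open>The order of vanishing at \<open>0\<close> shared by all numerators. After
    division by \<open>a^s\<close> some entry keeps a nonzero constant coefficient, which makes
    \<open>P 0\<close> nonzero and the weight \<open>s - N\<close>.\<close>
  define s where "s = (LEAST s. \<exists>i<d. \<exists>j<d. coeff (q i j) s \<noteq> 0)"
  obtain i0 j0 where i0: "i0 < d" "j0 < d" "coeff (q i0 j0) s \<noteq> 0"
    using LeastI_ex[OF \<open>\<exists>s. \<exists>i<d. \<exists>j<d. coeff (q i j) s \<noteq> 0\<close>] unfolding s_def by blast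
  have low: "coeff (q i j) t = 0" if "i < d" "j < d" "t < s" for i j t
    using not_less_Least[of t "\<lambda>s. \<exists>i<d. \<exists>j<d. coeff (q i j) s \<noteq> 0"] that
    unfolding s_def by blast
  define r where "r i j = poly_shift s (q i j)" for i j
  have qr: "q i j = monom 1 s * r i j" if "i < d" "j < d" for i j
    by (rule poly_eqI) (use low[OF that] in \<open>auto simp: coeff_monom_mult r_def coeff_poly_shift\<close>)
  define P where "P a = mat d d (\<lambda>(i, j). poly (r i j) a)" for a
  define m where "m = int s - int N"
  have carrP: "P a \<in> carrier_mat d d" for a by (simp add: P_def)
  have polyP: "polyfun (\<lambda>a. P a $$ (i, j))" if "i < d" "j < d" for i j
    using that unfolding P_def polyfun_def by auto
  have RP: "R a = (a powi m) \<cdot>\<^sub>m P a" if "a \<noteq> 0" for a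
  proof (rule eq_matI)
    fix i j assume "i < dim_row ((a powi m) \<cdot>\<^sub>m P a)" "j < dim_col ((a powi m) \<cdot>\<^sub>m P a)"
    then have ij: "i < d" "j < d" using carrP[of a] by auto
    show "R a $$ (i, j) = ((a powi m) \<cdot>\<^sub>m P a) $$ (i, j)"
      using ij that by (simp add: q qr P_def m_def poly_monom power_int_diff)
  qed (use carr[OF that] carrP[of a] in auto)
  have P0: "P 0 \<noteq> 0\<^sub>m d d"
  proof
    assume "P 0 = 0\<^sub>m d d"
    then have "P 0 $$ (i0, j0) = 0" using i0 by simp
    then show False using i0 by (simp add: P_def r_def poly_0_coeff_0 coeff_poly_shift)
  qed
  \<comment> \<open>The factor \<open>a powi m\<close> is itself multiplicative, so it cancels and
    leaves \<open>P\<close> multiplicative off \<open>0\<close>.\<close>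
  have PP: "P (a * b) = P a * P b" if "a \<noteq> 0" "b \<noteq> 0" for a b
  proof -
    have "((a * b) powi m) \<cdot>\<^sub>m P (a * b) = ((a powi m) \<cdot>\<^sub>m P a) * ((b powi m) \<cdot>\<^sub>m P b)"
      using mult[OF that] that by (simp add: RP)
    also have "\<dots> = (a powi m) \<cdot>\<^sub>m ((b powi m) \<cdot>\<^sub>m (P a * P b))"
      by (subst mult_smult_assoc_mat[OF carrP smult_carrier_mat[OF carrP]])
        (subst mult_smult_distrib[OF carrP carrP], rule refl)
    also have "\<dots> = ((a * b) powi m) \<cdot>\<^sub>m (P a * P b)"
      by (simp add: smult_smult_mat power_int_mult_distrib)
    finally have *: "((a * b) powi m) \<cdot>\<^sub>m P (a * b) = ((a * b) powi m) \<cdot>\<^sub>m (P a * P b)" .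
    have "inverse ((a * b) powi m) * ((a * b) powi m) = 1" using that by simp
    then show ?thesis
      using arg_cong[OF *, of "\<lambda>X. inverse ((a * b) powi m) \<cdot>\<^sub>m X"]
      unfolding smult_smult_mat by (simp add: one_smult_mat)
  qed
  have prod: "(A * B) $$ (i, j) = (\<Sum>k<d. A $$ (i, k) * B $$ (k, j))"
    if "A \<in> carrier_mat d d" "B \<in> carrier_mat d d" "i < d" "j < d" for A B :: "complex mat" and i j
    using that by (simp add: scalar_prod_def lessThan_atLeast0)
  \<comment> \<open>For fixed \<open>a\<close> both sides of \<open>P a * P b = P (a * b)\<close>
    are polynomial in \<open>b\<close>, so \<open>b = 0\<close> may be inserted.\<close>
  have L: "P a * P 0 = P 0" if "a \<noteq> 0" for a
  proof (rule eq_matI)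
    fix i j assume "i < dim_row (P 0)" "j < dim_col (P 0)"
    then have ij: "i < d" "j < d" using carrP[of 0] by auto
    have "(P a * P 0) $$ (i, j) = P (a * 0) $$ (i, j)"
      by (rule polyfun_eq_at_0[of "\<lambda>b. (P a * P b) $$ (i, j)" "\<lambda>b. P (a * b) $$ (i, j)"])
        (use ij in \<open>auto simp: prod[OF carrP carrP] PP[OF that]
            intro!: polyfun_sum polyfun_mult polyfun_const polyP polyfun_scale[of "\<lambda>b. P b $$ (i, j)"]\<close>)
    then show "(P a * P 0) $$ (i, j) = P 0 $$ (i, j)" by simp
  qed (use carrP[of a] carrP[of 0] in auto)
  have R: "P 0 * P a = P 0" if "a \<noteq> 0" for a
  proof (rule eq_matI)
    fix i j assume "i < dim_row (P 0)" "j < dim_col (P 0)"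
    then have ij: "i < d" "j < d" using carrP[of 0] by auto
    have "(P 0 * P a) $$ (i, j) = P (a * 0) $$ (i, j)"
      by (rule polyfun_eq_at_0[of "\<lambda>b. (P b * P a) $$ (i, j)" "\<lambda>b. P (a * b) $$ (i, j)"])
        (use ij in \<open>auto simp: prod[OF carrP carrP] PP[OF _ that] mult.commute[of a]
            intro!: polyfun_sum polyfun_mult polyfun_const polyP
              polyfun_scale[of "\<lambda>b. P b $$ (i, j)" a, unfolded mult.commute[of a]]\<close>)
    then show "(P 0 * P a) $$ (i, j) = P 0 $$ (i, j)" by simp
  qed (use carrP[of a] carrP[of 0] in auto)
  have RL: "R a * P 0 = (a powi m) \<cdot>\<^sub>m P 0" if "a \<noteq> 0" for a
    unfolding RP[OF that] mult_smult_assoc_mat[OF carrP carrP] L[OF that] ..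
  have RR: "P 0 * R a = (a powi m) \<cdot>\<^sub>m P 0" if "a \<noteq> 0" for a
    unfolding RP[OF that] mult_smult_distrib[OF carrP carrP] R[OF that] ..
  show thesis
  proof (rule that[where P = P and m = m])
  qed (fact carrP polyP RP P0 RL RR)+
qed

text \<open>The case of one-by-one matrices of \<open>lowest_weight\<close>: there
  \<open>P 0\<close> is a nonzero scalar and cancels from the eigenvector equation.\<close>

lemma laurentfun_character:
  fixes f :: "complex \<Rightarrow> complex"
  assumes "laurentfun f" "f 1 = 1"
    and "\<And>a b. a \<noteq> 0 \<Longrightarrow> b \<noteq> 0 \<Longrightarrow> f (a * b) = f a * f b"
  obtains (weight) m :: int where "\<And>a. a \<noteq> 0 \<Longrightarrow> f a = a powi m"
proof -
  let ?R = "\<lambda>a. mat 1 1 (\<lambda>_. f a) :: complex mat"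
  show thesis
  proof (rule lowest_weight[of 1 ?R])
    fix m :: int and P
    assume P: "\<And>a. P a \<in> carrier_mat 1 1" "P (0::complex) \<noteq> 0\<^sub>m 1 1"
      "\<And>a. a \<noteq> 0 \<Longrightarrow> ?R a * P 0 = (a powi m) \<cdot>\<^sub>m P 0"
    have "P 0 $$ (0, 0) \<noteq> 0"
    proof
      assume "P 0 $$ (0, 0) = 0"
      then have "P 0 = 0\<^sub>m 1 1" using P(1)[of 0] by (intro eq_matI) auto
      with P(2) show False ..
    qed
    moreover have "f a * P 0 $$ (0, 0) = a powi m * P 0 $$ (0, 0)" if "a \<noteq> 0" for a
      using arg_cong[OF P(3)[OF that], of "\<lambda>X. X $$ (0, 0)"] P(1)[of 0]
      by (simp add: scalar_prod_def)
    ultimately show thesis using weight[of m] by auto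
  next
    show "?R 1 = 1\<^sub>m 1"
      by (rule eq_matI) (auto simp: assms(2))
    fix a b :: complex assume "a \<noteq> 0" "b \<noteq> 0"
    then show "?R (a * b) = ?R a * ?R b"
      by (intro eq_matI) (auto simp: scalar_prod_def assms(3))
  qed (simp_all add: assms(1))
qed

section \<open>Matrices and traces\<close>

lemma index_mult_mat_sum:
  assumes "A \<in> carrier_mat m n" "B \<in> carrier_mat n p" "i < m" "j < p"
  shows "(A * B) $$ (i, j) = (\<Sum>k<n. A $$ (i, k) * B $$ (k, j))"
  using assms by (auto simp: scalar_prod_def lessThan_atLeast0)

lemma mat_trace_mult_comm:
  assumes "A \<in> carrier_mat m n" "B \<in> carrier_mat n m"
  shows "mat_trace (A * B) = mat_trace (B * A)"
proof -
  have "mat_trace (A * B) = (\<Sum>i<m. \<Sum>k<n. A $$ (i, k) * B $$ (k, i))"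
    using assms
    by (auto simp: mat_trace_def index_mult_mat_sum[OF assms] simp del: index_mult_mat(1) intro!: sum.cong)
  also have "\<dots> = (\<Sum>k<n. \<Sum>i<m. B $$ (k, i) * A $$ (i, k))"
    by (subst sum.swap) (simp add: mult.commute)
  also have "\<dots> = mat_trace (B * A)"
    using assms
    by (auto simp: mat_trace_def index_mult_mat_sum[OF assms(2,1)] simp del: index_mult_mat(1) intro!: sum.cong)
  finally show ?thesis .
qed

lemma mat_trace_add:
  assumes "A \<in> carrier_mat n n" "B \<in> carrier_mat n n"
  shows "mat_trace (A + B) = mat_trace A + mat_trace B"
  using assms by (simp add: mat_trace_def sum.distrib)

text \<open>A diagonal index \<open>l\<close> corresponds to the pair of \<open>l div n\<close> and
  \<open>l mod n\<close>, so the trace splits into \<open>m\<close> blocks of length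
  \<open>n\<close>.\<close>

lemma mat_trace_kronecker:
  assumes A: "A \<in> carrier_mat m m" and B: "B \<in> carrier_mat n n"
  shows "mat_trace (kronecker A B) = mat_trace A * mat_trace B"
proof -
  have "mat_trace (kronecker A B) =
      (\<Sum>i<m * n. A $$ (i div n, i div n) * B $$ (i mod n, i mod n))"
    using assms by (auto simp: mat_trace_def kronecker_def intro!: sum.cong)
  also have "\<dots> = (\<Sum>i<m. \<Sum>l = i * n..<i * n + n.
      A $$ (l div n, l div n) * B $$ (l mod n, l mod n))"
    by (rule sum.nat_group[symmetric])
  also have "\<dots> = (\<Sum>i<m. \<Sum>j<n. A $$ (i, i) * B $$ (j, j))"
  proof (rule sum.cong[OF refl])
    fix i
    have "(\<Sum>l = i * n..<i * n + n. A $$ (l div n, l div n) * B $$ (l mod n, l mod n)) =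
        (\<Sum>j = 0..<n. A $$ ((i * n + j) div n, (i * n + j) div n) *
          B $$ ((i * n + j) mod n, (i * n + j) mod n))"
      by (subst sum.atLeastLessThan_shift_0) simp
    also have "\<dots> = (\<Sum>j<n. A $$ (i, i) * B $$ (j, j))"
      by (auto simp: lessThan_atLeast0 intro!: sum.cong)
    finally show "(\<Sum>l = i * n..<i * n + n. A $$ (l div n, l div n) * B $$ (l mod n, l mod n)) =
        (\<Sum>j<n. A $$ (i, i) * B $$ (j, j))" .
  qed
  also have "\<dots> = mat_trace A * mat_trace B"
    using assms by (simp add: mat_trace_def sum_product)
  finally show ?thesis .
qed

lemma mult_mat_vec_unit:
  fixes B :: "'a::comm_semiring_1 mat"
  assumes "B \<in> carrier_mat n p" "j < p"
  shows "B *\<^sub>v unit_vec p j = col B j"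
  using assms by (intro eq_vecI) (auto simp: scalar_prod_right_unit)

text \<open>Each column of \<open>B\<close> lies in the image of \<open>A\<close> and is solved for
  separately. This supplies the linear section and the retraction of an exact sequence.\<close>

lemma mult_mat_solvable:
  fixes A :: "'a::comm_semiring_1 mat"
  assumes A: "A \<in> carrier_mat n m" and B: "B \<in> carrier_mat n p"
    and sub: "\<And>v. v \<in> carrier_vec p \<Longrightarrow> B *\<^sub>v v \<in> (\<lambda>u. A *\<^sub>v u) ` carrier_vec m"
  obtains X where "X \<in> carrier_mat m p" "A * X = B"
proof -
  have "\<forall>j. \<exists>u. j < p \<longrightarrow> u \<in> carrier_vec m \<and> A *\<^sub>v u = col B j"
    using sub[OF unit_vec_carrier] mult_mat_vec_unit[OF B] by (metis imageE)
  then obtain u where u: "\<And>j. j < p \<Longrightarrow> u j \<in> carrier_vec m"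
    "\<And>j. j < p \<Longrightarrow> A *\<^sub>v u j = col B j"
    by metis
  define X where "X = mat m p (\<lambda>(i, j). u j $ i)"
  have X: "X \<in> carrier_mat m p" by (simp add: X_def)
  have colX: "col X j = u j" if "j < p" for j
    using u(1)[OF that] that by (intro eq_vecI) (auto simp: X_def)
  have "A * X = B"
  proof (rule eq_matI)
    fix i j assume ij: "i < dim_row B" "j < dim_col B"
    then have "(A * X) $$ (i, j) = (A *\<^sub>v u j) $ i"
      using A B X colX by simp
    then show "(A * X) $$ (i, j) = B $$ (i, j)"
      using u(2) ij B by simp
  qed (use A B X in auto)
  with X show thesis by (rule that)
qed

text \<open>With \<open>S\<close> a linear section of \<open>P\<close> and \<open>L\<close> the retraction of \<open>I\<close> complementary to it,
  \<open>1 = I L + S P\<close> splits the trace of the middle term.\<close>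

lemma mat_trace_short_exact:
  assumes "short_exact H U V W"
    and g: "g \<in> H"
    and U: "snd U g \<in> carrier_mat (fst U) (fst U)"
    and V: "snd V g \<in> carrier_mat (fst V) (fst V)"
    and W: "snd W g \<in> carrier_mat (fst W) (fst W)"
  shows "mat_trace (snd V g) = mat_trace (snd U g) + mat_trace (snd W g)"
proof -
  define u v w where "u = fst U" and "v = fst V" and "w = fst W"
  note uvw = u_def[symmetric] v_def[symmetric] w_def[symmetric]
  obtain I P where I: "I \<in> carrier_mat v u" "I * snd U g = snd V g * I"
    and P: "P \<in> carrier_mat w v" "P * snd V g = snd W g * P"
    and inj: "inj_on (\<lambda>u. I *\<^sub>v u) (carrier_vec u)"
    and ker: "(\<lambda>u. I *\<^sub>v u) ` carrier_vec u = mat_kernel P"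
    and surj: "(\<lambda>v. P *\<^sub>v v) ` carrier_vec v = carrier_vec w"
    using assms(1) g unfolding short_exact_def module_homs_def uvw by auto
  note carr = U[unfolded uvw] V[unfolded uvw] W[unfolded uvw] I(1) P(1)
  obtain S where S: "S \<in> carrier_mat v w" "P * S = 1\<^sub>m w"
    using mult_mat_solvable[OF P(1) one_carrier_mat, of thesis] surj by fastforce
  have SP: "S * P \<in> carrier_mat v v" using S P by simp
  have compl: "1\<^sub>m v - S * P \<in> carrier_mat v v" using SP by (rule minus_carrier_mat)
  \<comment> \<open>Since \<open>P S = 1\<close>, the matrix \<open>1 - S P\<close> is annihilated
    by \<open>P\<close> and so maps into the image of \<open>I\<close>.\<close>
  have "(1\<^sub>m v - S * P) *\<^sub>v x \<in> (\<lambda>u. I *\<^sub>v u) ` carrier_vec u" if x: "x \<in> carrier_vec v" for x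
  proof -
    have "P *\<^sub>v ((1\<^sub>m v - S * P) *\<^sub>v x) = (P * (1\<^sub>m v - S * P)) *\<^sub>v x"
      by (rule assoc_mult_mat_vec[symmetric, OF P(1) compl x])
    also have "P * (1\<^sub>m v - S * P) = P * 1\<^sub>m v - P * (S * P)"
      by (rule mult_minus_distrib_mat[OF P(1) one_carrier_mat SP])
    also have "P * (S * P) = P"
      using assoc_mult_mat[OF P(1) S(1) P(1)] S(2) P(1) by simp
    also have "P * 1\<^sub>m v - P = 0\<^sub>m w v"
      using P(1) by simp
    also have "0\<^sub>m w v *\<^sub>v x = 0\<^sub>v w" using x by (intro eq_vecI) auto
    finally show ?thesis
      unfolding ker by (intro mat_kernelI[OF P(1)]) (use compl x in auto)
  qed
  then obtain L where L: "L \<in> carrier_mat u v" "I * L = 1\<^sub>m v - S * P"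
    using mult_mat_solvable[OF I(1) compl, of thesis] by blast
  have PI: "P * I = 0\<^sub>m w u"
  proof (rule eq_matI)
    fix i j assume ij: "i < dim_row (0\<^sub>m w u :: complex mat)" "j < dim_col (0\<^sub>m w u :: complex mat)"
    then have j: "j < u" by simp
    have "I *\<^sub>v unit_vec u j \<in> mat_kernel P" unfolding ker[symmetric] by auto
    then have "P *\<^sub>v (I *\<^sub>v unit_vec u j) = 0\<^sub>v w"
      using mat_kernelD[OF P(1)] by blast
    then have "(P *\<^sub>v col I j) $ i = 0" using ij mult_mat_vec_unit[OF I(1) j] by simp
    then show "(P * I) $$ (i, j) = 0\<^sub>m w u $$ (i, j)"
      using ij P(1) I(1) by simp
  qed (use P I in auto)
  \<comment> \<open>From \<open>P I = 0\<close> follows \<open>I (L I) = (1 - S P) I = I\<close>,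
    and injectivity of \<open>I\<close> cancels it column by column.\<close>
  have LI: "L * I = 1\<^sub>m u"
  proof -
    have eq: "I * (L * I) = I"
    proof -
      have "I * (L * I) = (1\<^sub>m v - S * P) * I"
        using assoc_mult_mat[OF I(1) L(1) I(1)] L(2) by simp
      also have "\<dots> = 1\<^sub>m v * I - S * P * I"
        by (rule minus_mult_distrib_mat[OF one_carrier_mat SP I(1)])
      also have "S * P * I = S * (P * I)" by (rule assoc_mult_mat[OF S(1) P(1) I(1)])
      also have "\<dots> = 0\<^sub>m v u" unfolding PI using S(1) by simp
      also have "1\<^sub>m v * I - 0\<^sub>m v u = I" using I(1) by (auto intro!: eq_matI)
      finally show ?thesis .
    qed
    have LIc: "L * I \<in> carrier_mat u u" using L I by simp
    have "col (L * I) j = unit_vec u j" if j: "j < u" for j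
    proof (rule inj_onD[OF inj])
      show "I *\<^sub>v col (L * I) j = I *\<^sub>v unit_vec u j"
      proof (rule eq_vecI)
        fix i assume "i < dim_vec (I *\<^sub>v unit_vec u j)"
        then have i: "i < v" using I(1) by simp
        have "(I *\<^sub>v col (L * I) j) $ i = (I * (L * I)) $$ (i, j)"
          using i j I(1) LIc by simp
        then show "(I *\<^sub>v col (L * I) j) $ i = (I *\<^sub>v unit_vec u j) $ i"
          unfolding eq using mult_mat_vec_unit[OF I(1) j] i j I(1) by simp
      qed (use I in auto)
    qed (use LIc j in auto)
    then show ?thesis
      using LIc by (intro mat_col_eqI) auto
  qed
  have one: "I * L + S * P = 1\<^sub>m v"
  proof -
    have "1\<^sub>m v - Q + Q = 1\<^sub>m v" if "Q \<in> carrier_mat v v" for Q :: "complex mat"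
      by (rule eq_matI) (use that in auto)
    from this[OF SP] show ?thesis unfolding L(2) .
  qed
  let ?V = "snd V g"
  have IL: "I * L \<in> carrier_mat v v" by (rule mult_carrier_mat[OF I(1) L(1)])
  \<comment> \<open>The intertwining relations and the cyclicity of the trace turn the two summands
    into \<open>tr (L I U) = tr U\<close> and \<open>tr (W P S) = tr W\<close>.\<close>
  have "mat_trace ?V = mat_trace (?V * (I * L + S * P))"
    using carr one by simp
  also have "?V * (I * L + S * P) = ?V * (I * L) + ?V * (S * P)"
    by (rule mult_add_distrib_mat[OF carr(2) IL SP])
  also have "mat_trace \<dots> = mat_trace (?V * (I * L)) + mat_trace (?V * (S * P))"
    using carr IL SP by (intro mat_trace_add[of _ v]) auto
  also have "?V * (I * L) = (I * snd U g) * L"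
    unfolding I(2) by (rule assoc_mult_mat[symmetric, OF carr(2) I(1) L(1)])
  also have "mat_trace \<dots> = mat_trace (L * (I * snd U g))"
    using carr L by (intro mat_trace_mult_comm[of _ v u]) auto
  also have "L * (I * snd U g) = snd U g"
    using assoc_mult_mat[OF L(1) I(1) carr(1)] LI carr(1) by simp
  also have "?V * (S * P) = (?V * S) * P"
    by (rule assoc_mult_mat[symmetric, OF carr(2) S(1) P(1)])
  also have "mat_trace \<dots> = mat_trace (P * (?V * S))"
    using carr S by (intro mat_trace_mult_comm[of _ v w]) auto
  also have "P * (?V * S) = snd W g"
    using assoc_mult_mat[OF P(1) carr(2) S(1)] assoc_mult_mat[OF carr(3) P(1) S(1)] P(2) S(2) carr(3)
    by simp
  finally show ?thesis .
qed

section \<open>Characters as functions on the representation ring\<close>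

text \<open>The additive extension of \<open>\<phi>\<close> to the free abelian group. It serves
  both for traces of virtual modules and, with exponents as generators, for the evaluation of
  Laurent polynomials.\<close>

definition frag_eval :: "('a \<Rightarrow> complex) \<Rightarrow> ('a \<Rightarrow>\<^sub>0 int) \<Rightarrow> complex" where
  "frag_eval \<phi> x = (\<Sum>a \<in> Poly_Mapping.keys x. of_int (Poly_Mapping.lookup x a) * \<phi> a)"

lemma frag_eval_superset:
  assumes "finite S" "Poly_Mapping.keys x \<subseteq> S"
  shows "frag_eval \<phi> x = (\<Sum>a\<in>S. of_int (Poly_Mapping.lookup x a) * \<phi> a)"
  unfolding frag_eval_def using assms by (intro sum.mono_neutral_left) (auto simp: in_keys_iff)

lemma frag_eval_0 [simp]: "frag_eval \<phi> 0 = 0"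
  by (simp add: frag_eval_def)

lemma frag_eval_of [simp]: "frag_eval \<phi> (frag_of a) = \<phi> a"
  by (simp add: frag_eval_def)

lemma frag_eval_add: "frag_eval \<phi> (x + y) = frag_eval \<phi> x + frag_eval \<phi> y"
proof -
  let ?S = "Poly_Mapping.keys x \<union> Poly_Mapping.keys y"
  have "frag_eval \<phi> (x + y) = (\<Sum>a\<in>?S. of_int (Poly_Mapping.lookup (x + y) a) * \<phi> a)"
    by (intro frag_eval_superset) (auto simp: Poly_Mapping.keys_add)
  also have "\<dots> = frag_eval \<phi> x + frag_eval \<phi> y"
    by (simp add: frag_eval_superset[of ?S] lookup_add sum.distrib ring_distribs)
  finally show ?thesis .
qed

lemma frag_eval_minus: "frag_eval \<phi> (- x) = - frag_eval \<phi> x"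
  by (simp add: frag_eval_def sum_negf)

lemma frag_eval_diff: "frag_eval \<phi> (x - y) = frag_eval \<phi> x - frag_eval \<phi> y"
  using frag_eval_add[of \<phi> x "- y"] by (simp add: frag_eval_minus)

lemma frag_eval_extend:
  "frag_eval \<phi> (frag_extend b x) = frag_eval (\<lambda>a. frag_eval \<phi> (b a)) x"
proof (induction x rule: frag_induction[OF subset_UNIV])
  case (3 x y)
  then show ?case by (simp add: frag_extend_diff frag_eval_diff)
qed simp_all

lemma frag_eval_cong:
  "(\<And>a. a \<in> Poly_Mapping.keys x \<Longrightarrow> \<phi> a = \<psi> a) \<Longrightarrow> frag_eval \<phi> x = frag_eval \<psi> x"
  by (simp add: frag_eval_def)

lemma frag_eval_mult_right: "frag_eval (\<lambda>a. \<phi> a * c) x = frag_eval \<phi> x * c"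
  by (simp add: frag_eval_def sum_distrib_right mult.assoc)

lemma frag_eval_mult_left: "frag_eval (\<lambda>a. c * \<phi> a) x = c * frag_eval \<phi> x"
  by (simp add: frag_eval_def sum_distrib_left mult.left_commute)

lemma virtual_character_eq:
  "virtual_character H x = (\<lambda>g\<in>H. frag_eval (\<lambda>V. mat_trace (snd V g)) x)"
  by (simp add: virtual_character_def frag_eval_def)

lemma carrier_free_rep_ring [simp]:
  "x \<in> carrier (free_rep_ring n H) \<longleftrightarrow> Poly_Mapping.keys x \<subseteq> algebraic_reps n H"
  by (simp add: free_rep_ring_def)

lemma carrier_free_rep_ring_eq:
  "carrier (free_rep_ring n H) = {x. Poly_Mapping.keys x \<subseteq> algebraic_reps n H}"
  by auto

lemma add_monoid_free_rep_ring:
  "add_monoid (free_rep_ring n H) = free_Abelian_group (algebraic_reps n H)"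
  by (simp add: free_rep_ring_def free_Abelian_group_def)

lemma algebraic_repsD:
  assumes "V \<in> algebraic_reps n H" "g \<in> H"
  shows "snd V g \<in> carrier_mat (fst V) (fst V)"
  using assms by (auto simp: algebraic_reps_def algebraic_hom_def hom_def carrier_GL_iff)

lemma algebraic_reps_mult:
  assumes "V \<in> algebraic_reps n H" "g \<in> H" "h \<in> H"
  shows "snd V (g * h) = snd V g * snd V h"
  using assms by (auto simp: algebraic_reps_def algebraic_hom_def hom_def)

lemma algebraic_reps_one:
  assumes "V \<in> algebraic_reps n H" "subgroup H (GL n)"
  shows "snd V (1\<^sub>m n) = 1\<^sub>m (fst V)"
proof -
  have "snd V \<in> hom (mat_group n H) (mat_group (fst V) (carrier (GL (fst V))))"
    using assms(1) by (auto simp: algebraic_reps_def algebraic_hom_def)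
  then have "snd V \<in> hom (mat_group n H) (GL (fst V))" by simp
  from hom_one[OF this subgroup.subgroup_is_group[OF assms(2) group_GL] group_GL]
  show ?thesis by simp
qed

section \<open>The subgroup of relations from short exact sequences\<close>

lemma subgroup_exact_relations:
  "subgroup (exact_relations n H) (free_Abelian_group (algebraic_reps n H))"
  unfolding exact_relations_def add_monoid_free_rep_ring
proof (rule group.generate_is_subgroup[OF group_free_Abelian_group], safe)
  fix U V W assume "U \<in> algebraic_reps n H" "V \<in> algebraic_reps n H" "W \<in> algebraic_reps n H"
  then have "Poly_Mapping.keys (frag_of V - (frag_of U + frag_of W)) \<subseteq> algebraic_reps n H"
    using keys_diff[of "frag_of V" "frag_of U + frag_of W"]
      Poly_Mapping.keys_add[of "frag_of U" "frag_of W"] by auto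
  then show "frag_of V - (frag_of U + frag_of W)
      \<in> carrier (free_Abelian_group (algebraic_reps n H))"
    by simp
qed

lemma exact_relations_keys:
  assumes "x \<in> exact_relations n H"
  shows "Poly_Mapping.keys x \<subseteq> algebraic_reps n H"
  using subgroup.mem_carrier[OF subgroup_exact_relations assms] by simp

lemma exact_relations_zero: "0 \<in> exact_relations n H"
  using subgroup.one_closed[OF subgroup_exact_relations] by simp

lemma exact_relations_add:
  "x \<in> exact_relations n H \<Longrightarrow> y \<in> exact_relations n H \<Longrightarrow> x + y \<in> exact_relations n H"
  using subgroup.m_closed[OF subgroup_exact_relations] by simp

lemma exact_relations_minus:
  "x \<in> exact_relations n H \<Longrightarrow> - x \<in> exact_relations n H"
  using subgroup.m_inv_closed[OF subgroup_exact_relations] exact_relations_keys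
  by (metis inv_free_Abelian_group)

lemma exact_relations_diff:
  "x \<in> exact_relations n H \<Longrightarrow> y \<in> exact_relations n H \<Longrightarrow> x - y \<in> exact_relations n H"
  using exact_relations_add[OF _ exact_relations_minus] by fastforce

lemma exact_relations_incl:
  assumes "U \<in> algebraic_reps n H" "V \<in> algebraic_reps n H" "W \<in> algebraic_reps n H"
    "short_exact H U V W"
  shows "frag_of V - (frag_of U + frag_of W) \<in> exact_relations n H"
  unfolding exact_relations_def using assms by (intro generate.incl) blast

text \<open>Each generator has trace zero by \<open>mat_trace_short_exact\<close>, and this passes
  to sums and negatives. It makes the character of a class independent of its
  representative.\<close>

lemma frag_eval_exact_relations:
  assumes "x \<in> exact_relations n H" "g \<in> H"
  shows "frag_eval (\<lambda>V. mat_trace (snd V g)) x = 0"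
proof -
  have *: "frag_eval (\<lambda>V. mat_trace (snd V g)) (frag_of V - (frag_of U + frag_of W)) = 0"
    if "U \<in> algebraic_reps n H" "V \<in> algebraic_reps n H" "W \<in> algebraic_reps n H"
      "short_exact H U V W" for U V W
    using mat_trace_short_exact[OF that(4) assms(2)] that(1-3) assms(2) algebraic_repsD
    by (simp add: frag_eval_diff frag_eval_add)
  show ?thesis
    using assms(1)
    unfolding exact_relations_def add_monoid_free_rep_ring
  proof (induction rule: generate.induct)
    \<comment> \<open>The inverse of the free abelian group is known to be negation only on its
      carrier, hence the detour through the support of \<open>h\<close>.\<close>
    case (inv h)
    then have "h \<in> exact_relations n H"
      unfolding exact_relations_def add_monoid_free_rep_ring by (rule generate.incl)
    from exact_relations_keys[OF this] inv * show ?case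
      by (auto simp: frag_eval_minus)
  qed (use * in \<open>auto simp: frag_eval_add\<close>)
qed

section \<open>Classes as cosets and the character homomorphism\<close>

lemma carrier_rep_ring_iff:
  "X \<in> carrier (rep_ring n H) \<longleftrightarrow>
     (\<exists>x. Poly_Mapping.keys x \<subseteq> algebraic_reps n H \<and> X = (\<lambda>i. i + x) ` exact_relations n H)"
proof -
  have "exact_relations n H +>\<^bsub>free_rep_ring n H\<^esub> x = (\<lambda>i. i + x) ` exact_relations n H" for x
    by (auto simp: a_r_coset_def' free_rep_ring_def)
  then have "carrier (rep_ring n H) = (\<Union>x\<in>{x. Poly_Mapping.keys x \<subseteq> algebraic_reps n H}.
      {(\<lambda>i. i + x) ` exact_relations n H})"
    by (simp add: rep_ring_def FactRing_def A_RCOSETS_def' carrier_free_rep_ring_eq)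
  then show ?thesis by blast
qed

text \<open>All members of the coset have one virtual character, and the coset is nonempty; that is
  what \<open>the_elem\<close> in the definition of \<open>character\<close> requires.\<close>

lemma character_coset:
  "character H ((\<lambda>i. i + x) ` exact_relations n H) = virtual_character H x"
proof -
  have "virtual_character H ` (\<lambda>i. i + x) ` exact_relations n H = {virtual_character H x}"
  proof -
    have "virtual_character H (i + x) = virtual_character H x" if "i \<in> exact_relations n H" for i
      using that by (auto simp: virtual_character_eq frag_eval_add frag_eval_exact_relations
          intro!: restrict_ext)
    then show ?thesis using exact_relations_zero by force
  qed
  then show ?thesis by (simp add: character_def)
qed

lemma character_image:
  "character H ` carrier (rep_ring n H) =
     virtual_character H ` {x. Poly_Mapping.keys x \<subseteq> algebraic_reps n H}"
proof -
  have "carrier (rep_ring n H) = (\<lambda>x. (\<lambda>i. i + x) ` exact_relations n H) `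
      {x. Poly_Mapping.keys x \<subseteq> algebraic_reps n H}"
    unfolding set_eq_iff carrier_rep_ring_iff by blast
  then show ?thesis by (simp add: image_image character_coset)
qed

lemma mat_trace_tensor_rep:
  assumes "V \<in> algebraic_reps n H" "W \<in> algebraic_reps n H" "g \<in> H"
  shows "mat_trace (snd (tensor_rep V W) g) = mat_trace (snd V g) * mat_trace (snd W g)"
  using mat_trace_kronecker[OF algebraic_repsD[OF assms(1,3)] algebraic_repsD[OF assms(2,3)]]
  by (simp add: tensor_rep_def)

lemma image_eq_singleton: "(\<And>z. z \<in> A \<Longrightarrow> f z = c) \<Longrightarrow> A \<noteq> {} \<Longrightarrow> f ` A = {c}"
  by auto

text \<open>Cyclicity of the trace makes the values class functions, and the trace of a Kronecker
  product makes the map multiplicative.\<close>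

lemma character_ring_hom:
  assumes H: "subgroup H (GL n)"
  shows "character H \<in> Ring.ring_hom (rep_ring n H) (class_function_ring n H)"
proof (rule ring_hom_memI)
  let ?R = "rep_ring n H" and ?I = "exact_relations n H"
  fix X assume "X \<in> carrier ?R"
  then obtain x where x: "Poly_Mapping.keys x \<subseteq> algebraic_reps n H" "X = (\<lambda>i. i + x) ` ?I"
    by (auto simp: carrier_rep_ring_iff)
  have "mat_trace (snd V (h * g * inv\<^bsub>GL n\<^esub> h)) = mat_trace (snd V g)"
    if V: "V \<in> algebraic_reps n H" and gh: "g \<in> H" "h \<in> H" for V g h
  proof -
    have h': "inv\<^bsub>GL n\<^esub> h \<in> H" by (rule subgroup.m_inv_closed[OF H gh(2)])
    have hg: "h * g \<in> H" using subgroup.m_closed[OF H gh(2,1)] by simp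
    have h'h: "inv\<^bsub>GL n\<^esub> h * h = 1\<^sub>m n"
      using group.l_inv[OF group_GL subgroup.mem_carrier[OF H gh(2)]] by simp
    note carr = algebraic_repsD[OF V]
    have "mat_trace (snd V (h * g * inv\<^bsub>GL n\<^esub> h)) = mat_trace (snd V (h * g) * snd V (inv\<^bsub>GL n\<^esub> h))"
      using algebraic_reps_mult[OF V hg h'] by simp
    also have "\<dots> = mat_trace (snd V (inv\<^bsub>GL n\<^esub> h) * snd V (h * g))"
      by (rule mat_trace_mult_comm[OF carr[OF hg] carr[OF h']])
    also have "snd V (inv\<^bsub>GL n\<^esub> h) * snd V (h * g) = snd V (inv\<^bsub>GL n\<^esub> h * h) * snd V g"
      using assoc_mult_mat[OF carr[OF h'] carr[OF gh(2)] carr[OF gh(1)]]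
      by (simp add: algebraic_reps_mult[OF V] gh h')
    also have "\<dots> = snd V g"
      unfolding h'h algebraic_reps_one[OF V H] using carr[OF gh(1)] by simp
    finally show ?thesis .
  qed
  then have "frag_eval (\<lambda>V. mat_trace (snd V (h * g * inv\<^bsub>GL n\<^esub> h))) x =
      frag_eval (\<lambda>V. mat_trace (snd V g)) x" if "g \<in> H" "h \<in> H" for g h
    using x(1) that by (intro frag_eval_cong) blast
  moreover have "h * g * inv\<^bsub>GL n\<^esub> h \<in> H" if "g \<in> H" "h \<in> H" for g h
    using subgroup.m_closed[OF H subgroup.m_closed[OF H that(2,1)] subgroup.m_inv_closed[OF H that(2)]]
    by simp
  ultimately show "character H X \<in> carrier (class_function_ring n H)"
    unfolding x(2) character_coset virtual_character_eq class_function_ring_def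
    by (auto simp: group.m_inv_consistent[OF group_GL H])
next
  let ?R = "rep_ring n H" and ?I = "exact_relations n H"
  fix X Y assume XY: "X \<in> carrier ?R" "Y \<in> carrier ?R"
  then obtain x y where x: "Poly_Mapping.keys x \<subseteq> algebraic_reps n H" "X = (\<lambda>i. i + x) ` ?I"
    and y: "Poly_Mapping.keys y \<subseteq> algebraic_reps n H" "Y = (\<lambda>i. i + y) ` ?I"
    by (auto simp: carrier_rep_ring_iff)
  let ?vc = "virtual_character H"
  have in_XY: "x \<in> X" "y \<in> Y"
    using x(2) y(2) exact_relations_zero[of n H] by (auto intro!: image_eqI[of _ _ 0])
  have keys: "Poly_Mapping.keys z \<subseteq> algebraic_reps n H"
    if "z \<in> (\<lambda>i. i + w) ` ?I" "Poly_Mapping.keys w \<subseteq> algebraic_reps n H" for z w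
    using that exact_relations_keys Poly_Mapping.keys_add by fastforce
  have ceq: "?vc z = ?vc w" if "z \<in> (\<lambda>i. i + w) ` ?I" for z w
    using that by (auto simp: virtual_character_eq frag_eval_add frag_eval_exact_relations
          intro!: restrict_ext)
  have mult: "?vc (a \<otimes>\<^bsub>free_rep_ring n H\<^esub> b) = ?vc a \<otimes>\<^bsub>class_function_ring n H\<^esub> ?vc b"
    if ab: "Poly_Mapping.keys a \<subseteq> algebraic_reps n H" "Poly_Mapping.keys b \<subseteq> algebraic_reps n H" for a b
  proof -
    have "frag_eval (\<lambda>V. mat_trace (snd V g)) (a \<otimes>\<^bsub>free_rep_ring n H\<^esub> b) =
        frag_eval (\<lambda>V. mat_trace (snd V g)) a * frag_eval (\<lambda>V. mat_trace (snd V g)) b"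
      if g: "g \<in> H" for g
    proof -
      have "frag_eval (\<lambda>V. mat_trace (snd V g)) (a \<otimes>\<^bsub>free_rep_ring n H\<^esub> b) =
          frag_eval (\<lambda>V. frag_eval (\<lambda>W. mat_trace (snd (tensor_rep V W) g)) b) a"
        by (simp add: free_rep_ring_def frag_eval_extend)
      also have "\<dots> = frag_eval (\<lambda>V. frag_eval (\<lambda>W. mat_trace (snd V g) * mat_trace (snd W g)) b) a"
        using ab g by (intro frag_eval_cong) (blast intro: mat_trace_tensor_rep)
      finally show ?thesis by (simp add: frag_eval_mult_left frag_eval_mult_right)
    qed
    then show ?thesis
      by (auto simp: virtual_character_eq class_function_ring_def intro!: restrict_ext)
  qed
  have "?vc ` (X \<otimes>\<^bsub>?R\<^esub> Y) = {?vc x \<otimes>\<^bsub>class_function_ring n H\<^esub> ?vc y}"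
  proof -
    \<comment> \<open>The product of two classes is a union over all pairs of representatives, so
      its virtual character has to be checked on every pair.\<close>
    have prod: "X \<otimes>\<^bsub>?R\<^esub> Y = (\<Union>a\<in>X. \<Union>b\<in>Y. (\<lambda>i. i + a \<otimes>\<^bsub>free_rep_ring n H\<^esub> b) ` ?I)"
      by (auto simp: rep_ring_def FactRing_def rcoset_mult_def a_r_coset_def' free_rep_ring_def)
    have "?vc z = ?vc x \<otimes>\<^bsub>class_function_ring n H\<^esub> ?vc y" if "z \<in> X \<otimes>\<^bsub>?R\<^esub> Y" for z
    proof -
      obtain a b where ab: "a \<in> X" "b \<in> Y" "z \<in> (\<lambda>i. i + a \<otimes>\<^bsub>free_rep_ring n H\<^esub> b) ` ?I"
        using \<open>z \<in> X \<otimes>\<^bsub>?R\<^esub> Y\<close> unfolding prod by blast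
      then show ?thesis
        using ceq[OF ab(3)] mult[of a b] keys[of a x] keys[of b y] ceq[of a x] ceq[of b y] x y by simp
    qed
    moreover have "X \<otimes>\<^bsub>?R\<^esub> Y \<noteq> {}"
      unfolding prod using in_XY exact_relations_zero[of n H] by blast
    ultimately show ?thesis by (rule image_eq_singleton)
  qed
  then show "character H (X \<otimes>\<^bsub>?R\<^esub> Y) = character H X \<otimes>\<^bsub>class_function_ring n H\<^esub> character H Y"
    unfolding x(2) y(2) character_coset by (simp add: character_def)
  have "?vc ` (X \<oplus>\<^bsub>?R\<^esub> Y) = {?vc x \<oplus>\<^bsub>class_function_ring n H\<^esub> ?vc y}"
  proof -
    have sum: "X \<oplus>\<^bsub>?R\<^esub> Y = (\<Union>a\<in>X. \<Union>b\<in>Y. {a + b})"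
      by (auto simp: rep_ring_def FactRing_def set_add_def set_mult_def free_rep_ring_def)
    have add: "?vc (a + b) = ?vc a \<oplus>\<^bsub>class_function_ring n H\<^esub> ?vc b" for a b
      by (auto simp: virtual_character_eq class_function_ring_def frag_eval_add intro!: restrict_ext)
    have "?vc z = ?vc x \<oplus>\<^bsub>class_function_ring n H\<^esub> ?vc y" if "z \<in> X \<oplus>\<^bsub>?R\<^esub> Y" for z
    proof -
      obtain a b where ab: "a \<in> X" "b \<in> Y" "z = a + b"
        using \<open>z \<in> X \<oplus>\<^bsub>?R\<^esub> Y\<close> unfolding sum by blast
      then show ?thesis
        using ceq[of a x] ceq[of b y] x(2) y(2) by (simp add: add)
    qed
    moreover have "X \<oplus>\<^bsub>?R\<^esub> Y \<noteq> {}"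
      unfolding sum using in_XY by blast
    ultimately show ?thesis by (rule image_eq_singleton)
  qed
  then show "character H (X \<oplus>\<^bsub>?R\<^esub> Y) = character H X \<oplus>\<^bsub>class_function_ring n H\<^esub> character H Y"
    unfolding x(2) y(2) character_coset by (simp add: character_def)
next
  have "\<one>\<^bsub>rep_ring n H\<^esub> = (\<lambda>i. i + frag_of trivial_rep) ` exact_relations n H"
    by (auto simp: rep_ring_def FactRing_def a_r_coset_def' free_rep_ring_def)
  then show "character H \<one>\<^bsub>rep_ring n H\<^esub> = \<one>\<^bsub>class_function_ring n H\<^esub>"
    by (simp add: character_coset virtual_character_eq class_function_ring_def
        trivial_rep_def mat_trace_def)
qed

section \<open>Groups contracted onto a one-parameter subgroup\<close>

text \<open>Distinct integral powers are linearly independent: multiplication by a high power of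
  \<open>z\<close> clears negative exponents and leaves a polynomial with infinitely many
  roots.\<close>

lemma frag_eval_power_int_eq_0:
  assumes zero: "\<And>z. z \<noteq> 0 \<Longrightarrow> frag_eval (\<lambda>m. z powi m) c = 0"
  shows "c = 0"
proof (rule ccontr)
  assume "c \<noteq> 0"
  then obtain m0 where m0: "m0 \<in> Poly_Mapping.keys c"
    using keys_eq_empty by blast
  let ?K = "Poly_Mapping.keys c"
  define N where "N = nat (\<Sum>m\<in>?K. \<bar>m\<bar>)"
  have N: "0 \<le> m + int N" if "m \<in> ?K" for m
  proof -
    have "\<bar>m\<bar> \<le> (\<Sum>m\<in>?K. \<bar>m\<bar>)" using that by (intro member_le_sum) auto
    then show ?thesis unfolding N_def by linarith
  qed
  define p where "p = (\<Sum>m\<in>?K. monom (of_int (Poly_Mapping.lookup c m) :: complex) (nat (m + int N)))"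
  have p: "poly p z = z ^ N * frag_eval (\<lambda>m. z powi m) c" if "z \<noteq> 0" for z
  proof -
    have "z ^ nat (m + int N) = z ^ N * z powi m" if "m \<in> ?K" for m
    proof -
      have "z ^ nat (m + int N) = z powi (m + int N)"
        using N[OF that] by (simp add: power_int_def)
      then show ?thesis using \<open>z \<noteq> 0\<close> by (simp add: power_int_add)
    qed
    then show ?thesis
      by (simp add: p_def frag_eval_def poly_sum poly_monom sum_distrib_left mult.left_commute)
  qed
  have "infinite {z. poly p z = 0}"
    using p zero infinite_UNIV_char_0[where 'a = complex]
      finite_subset[of "UNIV - {0::complex}" "{z. poly p z = 0}"] by auto
  then have "p = 0" using poly_roots_finite by blast
  then have "0 = coeff p (nat (m0 + int N))" by simp
  \<comment> \<open>All shifted exponents are nonnegative, so \<open>nat\<close> does not merge two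
    of them and only \<open>m0\<close> contributes.\<close>
  also have "\<dots> = (\<Sum>m\<in>?K. if m = m0 then of_int (Poly_Mapping.lookup c m0) else 0)"
    unfolding p_def coeff_sum
    by (intro sum.cong refl) (use N m0 in \<open>auto dest!: eq_nat_nat_iff[THEN iffD1, rotated 2]\<close>)
  also have "\<dots> = of_int (Poly_Mapping.lookup c m0)" using m0 by simp
  finally show False using m0 by (simp add: in_keys_iff)
qed

text \<open>Coordinates adapted to a pivot \<open>i\<close> with \<open>v $ i\<close> nonzero:
  \<open>P\<close> uses coordinate \<open>i\<close> to eliminate \<open>v\<close> and keeps the
  others, \<open>S\<close> inserts a zero at position \<open>i\<close>, and \<open>L\<close> reads
  coordinate \<open>i\<close> divided by \<open>v $ i\<close>.\<close>

lemma complement_of_vector: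
  fixes v :: "'a::field vec"
  assumes v: "v \<in> carrier_vec d" "v \<noteq> 0\<^sub>v d"
  defines "I \<equiv> mat d 1 (\<lambda>(i, _). v $ i)"
  obtains P S L where "P \<in> carrier_mat (d - 1) d" "S \<in> carrier_mat d (d - 1)" "L \<in> carrier_mat 1 d"
    "P * S = 1\<^sub>m (d - 1)" "P * I = 0\<^sub>m (d - 1) 1" "L * I = 1\<^sub>m 1" "I * L + S * P = 1\<^sub>m d"
proof -
  obtain i where i: "i < d" "v $ i \<noteq> 0"
  proof (rule ccontr)
    assume "\<not> thesis"
    then have "v = 0\<^sub>v d" using that v(1) by (intro eq_vecI) auto
    with v(2) show False ..
  qed
  \<comment> \<open>\<open>sk\<close> enumerates the indices other than \<open>i\<close>;
    \<open>us\<close> below is its inverse.\<close>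
  define sk where "sk j = (if j < i then j else Suc j)" for j
  have sk: "sk j < d" if "j < d - 1" for j using that i unfolding sk_def by auto
  have sk_neq: "sk j \<noteq> i" for j unfolding sk_def by auto
  have sk_inj: "sk j = sk j' \<longleftrightarrow> j = j'" for j j' unfolding sk_def by auto
  define us where "us l = (if l < i then l else l - 1)" for l
  have us: "l \<noteq> i \<Longrightarrow> sk (us l) = l" "l \<noteq> i \<Longrightarrow> l < d \<Longrightarrow> us l < d - 1" for l
    using i unfolding sk_def us_def by auto
  define P where "P = mat (d - 1) d (\<lambda>(j, l). (if l = sk j then 1 else 0) - (if l = i then v $ sk j / v $ i else 0))"
  define S where "S = mat d (d - 1) (\<lambda>(l, j). if l = sk j then 1 else (0::'a))"
  define L where "L = mat 1 d (\<lambda>(_, l). if l = i then 1 / v $ i else 0)"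
  have carr: "P \<in> carrier_mat (d - 1) d" "S \<in> carrier_mat d (d - 1)" "L \<in> carrier_mat 1 d" "I \<in> carrier_mat d 1"
    by (simp_all add: P_def S_def L_def I_def)
  have sum: "(A * B) $$ (j, l) = (\<Sum>k<b. A $$ (j, k) * B $$ (k, l))"
    if "A \<in> carrier_mat a b" "B \<in> carrier_mat b c" "j < a" "l < c" for A B :: "'a mat" and a b c j l
    by (rule index_mult_mat_sum[OF that])
  have PS: "P * S = 1\<^sub>m (d - 1)"
  proof (rule eq_matI)
    fix j l assume "j < dim_row (1\<^sub>m (d - 1) :: 'a mat)" "l < dim_col (1\<^sub>m (d - 1) :: 'a mat)"
    then have jl: "j < d - 1" "l < d - 1" by auto
    have "(P * S) $$ (j, l) = (\<Sum>k<d. if k = sk l then P $$ (j, sk l) else 0)"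
      unfolding sum[OF carr(1,2) jl] using jl by (intro sum.cong refl) (auto simp: S_def)
    also have "\<dots> = P $$ (j, sk l)" using sk[OF jl(2)] by simp
    also have "\<dots> = 1\<^sub>m (d - 1) $$ (j, l)"
      using jl sk[OF jl(2)] sk_neq by (simp add: P_def sk_inj)
    finally show "(P * S) $$ (j, l) = 1\<^sub>m (d - 1) $$ (j, l)" .
  qed (use carr in auto)
  have PI: "P * I = 0\<^sub>m (d - 1) 1"
  proof (rule eq_matI)
    fix j l assume "j < dim_row (0\<^sub>m (d - 1) 1 :: 'a mat)" "l < dim_col (0\<^sub>m (d - 1) 1 :: 'a mat)"
    then have jl: "j < d - 1" "l < 1" by auto
    have "(P * I) $$ (j, l) =
        (\<Sum>k<d. (if k = sk j then v $ sk j else 0) - (if k = i then v $ sk j else 0))"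
      unfolding sum[OF carr(1,4) jl] using jl i by (intro sum.cong refl) (auto simp: P_def I_def)
    also have "\<dots> = 0" using sk[OF jl(1)] i by (simp add: sum_subtractf)
    finally show "(P * I) $$ (j, l) = 0\<^sub>m (d - 1) 1 $$ (j, l)" using jl by simp
  qed (use carr in auto)
  have LI: "L * I = 1\<^sub>m 1"
  proof (rule eq_matI)
    fix j l assume "j < dim_row (1\<^sub>m 1 :: 'a mat)" "l < dim_col (1\<^sub>m 1 :: 'a mat)"
    then have jl: "j < 1" "l < 1" by auto
    have "(L * I) $$ (j, l) = (\<Sum>k<d. if k = i then 1 else 0)"
      unfolding sum[OF carr(3,4) jl] using jl i by (intro sum.cong refl) (auto simp: L_def I_def)
    then show "(L * I) $$ (j, l) = 1\<^sub>m 1 $$ (j, l)" using jl i by simp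
  qed (use carr in auto)
  have ILc: "I * L \<in> carrier_mat d d" and SPc: "S * P \<in> carrier_mat d d"
    using carr by auto
  have "I * L + S * P = 1\<^sub>m d"
  proof (rule eq_matI)
    fix l m assume "l < dim_row (1\<^sub>m d :: 'a mat)" "m < dim_col (1\<^sub>m d :: 'a mat)"
    then have lm: "l < d" "m < d" by auto
    have IL: "(I * L) $$ (l, m) = (if m = i then v $ l / v $ i else 0)"
      unfolding sum[OF carr(4,3) lm] using lm by (simp add: I_def L_def)
    have SP: "(S * P) $$ (l, m) = (if l = i then 0 else P $$ (us l, m))"
    proof (cases "l = i")
      case True
      have "S $$ (l, k) = 0" if "k < d - 1" for k
        using True lm that sk_neq[of k] by (simp add: S_def)
      then show ?thesis unfolding sum[OF carr(2,1) lm] using True by simp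
    next
      case False
      have "(S * P) $$ (l, m) = (\<Sum>k<d - 1. if k = us l then P $$ (us l, m) else 0)"
        unfolding sum[OF carr(2,1) lm] using lm us(1)[OF False] sk_inj
        by (intro sum.cong refl) (auto simp: S_def)
      then show ?thesis using False us(2)[OF False lm(1)] by simp
    qed
    have "(I * L + S * P) $$ (l, m) = (I * L) $$ (l, m) + (S * P) $$ (l, m)"
      using lm SPc by (intro index_add_mat(1)) auto
    also have "\<dots> = 1\<^sub>m d $$ (l, m)"
      unfolding IL SP using lm us[of l] i by (auto simp: P_def)
    finally show "(I * L + S * P) $$ (l, m) = 1\<^sub>m d $$ (l, m)" .
  qed (use ILc SPc in auto)
  with carr PS PI LI show thesis by (intro that) auto
qed

text \<open>What \<open>G_k\<close> and a nontrivial torus have in common. For nonzero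
  \<open>b\<close> the matrix \<open>M b\<close> is the conjugate of \<open>g\<close> by
  \<open>\<tau> b\<close>; the assumption says that this family extends to \<open>b = 0\<close>
  inside \<open>H\<close>. Polynomial dependence is asked for all regular functions, so that it
  carries over to the entries of any representation.\<close>

locale contracted_group =
  fixes n :: nat and H :: "complex mat set" and \<chi> :: "complex mat \<Rightarrow> complex"
    and \<tau> :: "complex \<Rightarrow> complex mat"
  assumes H: "subgroup H (GL n)"
    and \<chi>_regular: "regular_on n H \<chi>"
    and inverse_\<chi>_regular: "regular_on n H (\<lambda>g. inverse (\<chi> g))"
    and \<chi>_mult: "\<And>g h. g \<in> H \<Longrightarrow> h \<in> H \<Longrightarrow> \<chi> (g * h) = \<chi> g * \<chi> h"
    and \<chi>_nonzero: "\<And>g. g \<in> H \<Longrightarrow> \<chi> g \<noteq> 0"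
    and \<tau>_mem: "\<And>a. a \<noteq> 0 \<Longrightarrow> \<tau> a \<in> H"
    and \<chi>_\<tau>: "\<And>a. a \<noteq> 0 \<Longrightarrow> \<chi> (\<tau> a) = a"
    and \<tau>_mult: "\<And>a b. a \<noteq> 0 \<Longrightarrow> b \<noteq> 0 \<Longrightarrow> \<tau> (a * b) = \<tau> a * \<tau> b"
    and \<tau>_laurent: "\<And>f. f \<in> regular_functions n \<Longrightarrow> laurentfun (\<lambda>a. f (\<tau> a))"
    and contraction: "\<And>g. g \<in> H \<Longrightarrow> \<exists>M. (\<forall>b. M b \<in> H) \<and>
      (\<forall>b. b \<noteq> 0 \<longrightarrow> g * \<tau> b = \<tau> b * M b) \<and> M 0 = \<tau> (\<chi> g) \<and>
      (\<forall>f \<in> regular_functions n. polyfun (\<lambda>b. f (M b)))"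
begin

lemma \<tau>_one: "\<tau> 1 = 1\<^sub>m n"
proof -
  interpret group "GL n" by (rule group_GL)
  have "\<tau> 1 \<in> carrier (GL n)" using subgroup.mem_carrier[OF H] \<tau>_mem by simp
  moreover have "\<tau> 1 \<otimes>\<^bsub>GL n\<^esub> \<tau> 1 = \<tau> 1" using \<tau>_mult[of 1 1] by simp
  ultimately show ?thesis using l_cancel_one[of "\<tau> 1" "\<tau> 1"] by simp
qed

text \<open>Conjugation by \<open>\<tau> b\<close> contracts \<open>g\<close> to \<open>\<tau> (\<chi> g)\<close> as \<open>b\<close> tends to \<open>0\<close>; hence
  the lowest weight space of the one-parameter group \<open>\<tau>\<close> consists of common eigenvectors.\<close>

lemma common_eigenvector:
  assumes V: "V \<in> algebraic_reps n H" and d: "0 < fst V"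
  obtains m :: int and v where "v \<in> carrier_vec (fst V)" "v \<noteq> 0\<^sub>v (fst V)"
    "\<And>g. g \<in> H \<Longrightarrow> snd V g *\<^sub>v v = (\<chi> g powi m) \<cdot>\<^sub>v v"
proof -
  define d \<rho> where "d = fst V" and "\<rho> = snd V"
  note carr = algebraic_repsD[OF V, folded d_def \<rho>_def]
  note mult = algebraic_reps_mult[OF V, folded \<rho>_def]
  have entry: "\<exists>f \<in> regular_functions n. \<forall>g\<in>H. \<rho> g $$ (i, j) = f g" if "i < d" "j < d" for i j
    using V that by (auto simp: algebraic_reps_def algebraic_hom_def regular_on_def d_def \<rho>_def)
  have one: "\<rho> (\<tau> 1) = 1\<^sub>m d"
    using algebraic_reps_one[OF V H] by (simp add: \<tau>_one d_def \<rho>_def)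
  have laurent: "laurentfun (\<lambda>a. \<rho> (\<tau> a) $$ (i, j))" if ij: "i < d" "j < d" for i j
  proof -
    obtain f where f: "f \<in> regular_functions n" "\<And>g. g \<in> H \<Longrightarrow> \<rho> g $$ (i, j) = f g"
      using entry[OF ij] by blast
    then show ?thesis using \<tau>_mem by (intro laurentfun_cong[OF \<tau>_laurent[OF f(1)]]) simp
  qed
  show thesis
  proof (rule lowest_weight[of d "\<lambda>a. \<rho> (\<tau> a)"])
    fix m :: int and P
    assume P: "\<And>a. P a \<in> carrier_mat d d"
      and polyP: "\<And>i j. i < d \<Longrightarrow> j < d \<Longrightarrow> polyfun (\<lambda>a. P a $$ (i, j))"
      and RP: "\<And>a. a \<noteq> 0 \<Longrightarrow> \<rho> (\<tau> a) = (a powi m) \<cdot>\<^sub>m P a"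
      and P0: "P 0 \<noteq> 0\<^sub>m d d"
      and PR: "\<And>a. a \<noteq> 0 \<Longrightarrow> P 0 * \<rho> (\<tau> a) = (a powi m) \<cdot>\<^sub>m P 0"
    have eigen: "\<rho> g * P 0 = (\<chi> g powi m) \<cdot>\<^sub>m P 0" if g: "g \<in> H" for g
    proof -
      obtain M where M: "\<And>b. M b \<in> H" "\<And>b. b \<noteq> 0 \<Longrightarrow> g * \<tau> b = \<tau> b * M b" "M 0 = \<tau> (\<chi> g)"
        "\<And>f. f \<in> regular_functions n \<Longrightarrow> polyfun (\<lambda>b. f (M b))"
        using contraction[OF g] by blast
      \<comment> \<open>\<open>M b\<close> lies in \<open>H\<close> at \<open>b = 0\<close> as well,
        so the regular function that represents the entry may be used for every
        \<open>b\<close>.\<close>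
      have polyM: "polyfun (\<lambda>b. \<rho> (M b) $$ (i, j))" if ij: "i < d" "j < d" for i j
      proof -
        obtain f where f: "f \<in> regular_functions n" "\<And>g. g \<in> H \<Longrightarrow> \<rho> g $$ (i, j) = f g"
          using entry[OF ij] by blast
        then show ?thesis using M(4)[OF f(1)] M(1) by simp
      qed
      have comm: "\<rho> g * P b = P b * \<rho> (M b)" if b: "b \<noteq> 0" for b
      proof -
        have "(b powi m) \<cdot>\<^sub>m (\<rho> g * P b) = \<rho> g * \<rho> (\<tau> b)"
          unfolding RP[OF b] by (rule mult_smult_distrib[OF carr[OF g] P, symmetric])
        also have "\<dots> = \<rho> (\<tau> b) * \<rho> (M b)"
          using mult[OF g \<tau>_mem[OF b]] mult[OF \<tau>_mem[OF b] M(1)[of b]] M(2)[OF b] by simp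
        also have "\<dots> = (b powi m) \<cdot>\<^sub>m (P b * \<rho> (M b))"
          unfolding RP[OF b] by (rule mult_smult_assoc_mat[OF P carr[OF M(1)]])
        finally have "inverse (b powi m) \<cdot>\<^sub>m ((b powi m) \<cdot>\<^sub>m (\<rho> g * P b)) =
            inverse (b powi m) \<cdot>\<^sub>m ((b powi m) \<cdot>\<^sub>m (P b * \<rho> (M b)))"
          by simp
        then show ?thesis using b unfolding smult_smult_mat by (simp add: one_smult_mat)
      qed
      have "\<rho> g * P 0 = P 0 * \<rho> (M 0)"
      proof (rule eq_matI)
        fix i j assume "i < dim_row (P 0 * \<rho> (M 0))" "j < dim_col (P 0 * \<rho> (M 0))"
        then have ij: "i < d" "j < d" using P[of 0] carr[OF M(1)[of 0]] by auto
        show "(\<rho> g * P 0) $$ (i, j) = (P 0 * \<rho> (M 0)) $$ (i, j)"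
        proof (rule polyfun_eq_at_0)
          show "polyfun (\<lambda>b. (\<rho> g * P b) $$ (i, j))"
            unfolding index_mult_mat_sum[OF carr[OF g] P ij]
            by (intro polyfun_sum polyfun_mult polyfun_const polyP) (use ij in auto)
          show "polyfun (\<lambda>b. (P b * \<rho> (M b)) $$ (i, j))"
            unfolding index_mult_mat_sum[OF P carr[OF M(1)] ij]
            by (intro polyfun_sum polyfun_mult polyP polyM) (use ij in auto)
        qed (simp add: comm)
      qed (use P[of 0] carr[OF M(1)[of 0]] carr[OF g] in auto)
      \<comment> \<open>Here \<open>M 0\<close> is the scaling by \<open>\<chi> g\<close>, which
        \<open>P 0\<close> absorbs as the factor \<open>\<chi> g powi m\<close>.\<close>
      then show ?thesis using PR[OF \<chi>_nonzero[OF g]] by (simp add: M(3))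
    qed
    obtain i j where ij: "i < d" "j < d" "P 0 $$ (i, j) \<noteq> 0"
    proof (rule ccontr)
      assume "\<not> thesis"
      then have "P 0 = 0\<^sub>m d d" using that P[of 0] by (intro eq_matI) auto
      with P0 show False ..
    qed
    show thesis
    proof (rule that[of "col (P 0) j" m])
      show "col (P 0) j \<in> carrier_vec (fst V)" using P[of 0] unfolding d_def carrier_vec_def by simp
      have "col (P 0) j $ i \<noteq> 0" using ij P[of 0] by simp
      then show "col (P 0) j \<noteq> 0\<^sub>v (fst V)" using ij unfolding d_def by auto
      fix g assume g: "g \<in> H"
      have "col (\<rho> g * P 0) j = col ((\<chi> g powi m) \<cdot>\<^sub>m P 0) j" by (simp add: eigen[OF g])
      moreover have "col (\<rho> g * P 0) j = \<rho> g *\<^sub>v col (P 0) j"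
        using ij by (intro col_mult2[OF carr[OF g] P])
      moreover have "col ((\<chi> g powi m) \<cdot>\<^sub>m P 0) j = (\<chi> g powi m) \<cdot>\<^sub>v col (P 0) j"
        using ij P[of 0] by (intro eq_vecI) auto
      ultimately show "snd V g *\<^sub>v col (P 0) j = (\<chi> g powi m) \<cdot>\<^sub>v col (P 0) j"
        by (simp add: \<rho>_def)
    qed
  qed (use assms carr one laurent \<tau>_mem in \<open>simp_all add: d_def[symmetric] \<tau>_mult mult\<close>)
qed

definition weight_rep :: "int \<Rightarrow> rep" where
  "weight_rep m = (1, \<lambda>g. mat 1 1 (\<lambda>_. \<chi> g powi m))"

lemma mat_trace_weight_rep: "mat_trace (snd (weight_rep m) g) = \<chi> g powi m"
  by (simp add: weight_rep_def mat_trace_def)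

lemma weight_rep_algebraic: "weight_rep m \<in> algebraic_reps n H"
proof -
  have "regular_on n H (\<lambda>g. \<chi> g powi m)"
    by (cases "0 \<le> m") (simp_all add: power_int_def regular_on_power \<chi>_regular inverse_\<chi>_regular)
  moreover have "mat 1 1 (\<lambda>_. c) \<in> carrier (GL 1)" if "c \<noteq> 0" for c :: complex
    using that by (simp add: carrier_GL_iff det_single)
  moreover have "mat 1 1 (\<lambda>_. c * e) = mat 1 1 (\<lambda>_. c) * mat 1 1 (\<lambda>_. e)" for c e :: complex
    by (rule eq_matI) (auto simp: scalar_prod_def)
  ultimately show ?thesis
    by (auto simp: weight_rep_def algebraic_reps_def algebraic_hom_def hom_def \<chi>_mult \<chi>_nonzero
        power_int_mult_distrib)
qed

text \<open>The quotient by the line of \<open>v\<close>, written in coordinates: with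
  \<open>P\<close> the projection and \<open>S\<close> a linear section of it, \<open>g\<close> acts
  by \<open>P * \<rho> g * S\<close>.\<close>

lemma quotient_by_eigenvector:
  assumes V: "V \<in> algebraic_reps n H"
    and v: "v \<in> carrier_vec (fst V)" "v \<noteq> 0\<^sub>v (fst V)"
    and eigen: "\<And>g. g \<in> H \<Longrightarrow> snd V g *\<^sub>v v = (\<chi> g powi m) \<cdot>\<^sub>v v"
  obtains W where "W \<in> algebraic_reps n H" "fst W = fst V - 1" "short_exact H (weight_rep m) V W"
proof -
  define d \<rho> where "d = fst V" and "\<rho> = snd V"
  define I where "I = mat d 1 (\<lambda>(i, _). v $ i)"
  note carr = algebraic_repsD[OF V, folded d_def \<rho>_def]
  note mult = algebraic_reps_mult[OF V, folded \<rho>_def]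
  obtain P S L where P: "P \<in> carrier_mat (d - 1) d" and S: "S \<in> carrier_mat d (d - 1)"
    and L: "L \<in> carrier_mat 1 d" and PS: "P * S = 1\<^sub>m (d - 1)" and PI: "P * I = 0\<^sub>m (d - 1) 1"
    and LI: "L * I = 1\<^sub>m 1" and one: "I * L + S * P = 1\<^sub>m d"
    using complement_of_vector[OF v] unfolding d_def[symmetric] I_def[symmetric] by metis
  have I: "I \<in> carrier_mat d 1" by (simp add: I_def)
  have \<rho>I: "\<rho> g * I = (\<chi> g powi m) \<cdot>\<^sub>m I" if g: "g \<in> H" for g
  proof (rule eq_matI)
    fix i j assume "i < dim_row ((\<chi> g powi m) \<cdot>\<^sub>m I)" "j < dim_col ((\<chi> g powi m) \<cdot>\<^sub>m I)"
    then have ij: "i < d" "j = 0" using I by auto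
    have "col I 0 = v" using v I by (intro eq_vecI) (auto simp: I_def d_def)
    then have "(\<rho> g * I) $$ (i, j) = (\<rho> g *\<^sub>v v) $ i"
      using ij carr[OF g] I by simp
    also have "\<dots> = \<chi> g powi m * v $ i"
      using eigen[OF g] ij v by (simp add: \<rho>_def d_def)
    finally show "(\<rho> g * I) $$ (i, j) = ((\<chi> g powi m) \<cdot>\<^sub>m I) $$ (i, j)"
      using ij I by (simp add: I_def)
  qed (use carr[OF g] I in auto)
  define \<sigma> where "\<sigma> g = P * \<rho> g * S" for g
  have \<sigma>_carr: "\<sigma> g \<in> carrier_mat (d - 1) (d - 1)" if "g \<in> H" for g
    unfolding \<sigma>_def using P S carr[OF that] by auto
  have P\<rho>c: "P * \<rho> g \<in> carrier_mat (d - 1) d" if "g \<in> H" for g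
    using P carr[OF that] by auto
  have IL: "I * L \<in> carrier_mat d d" and SP: "S * P \<in> carrier_mat d d"
    using I L S P by auto
  have P\<rho>I: "P * \<rho> g * I = 0\<^sub>m (d - 1) 1" if g: "g \<in> H" for g
  proof -
    have "P * \<rho> g * I = P * ((\<chi> g powi m) \<cdot>\<^sub>m I)"
      unfolding \<rho>I[OF g, symmetric] by (rule assoc_mult_mat[OF P carr[OF g] I])
    also have "\<dots> = (\<chi> g powi m) \<cdot>\<^sub>m (P * I)" by (rule mult_smult_distrib[OF P I])
    finally show ?thesis by (simp add: PI)
  qed
  \<comment> \<open>In the splitting \<open>1 = I L + S P\<close> the first part contributes
    nothing, since \<open>\<rho> g\<close> preserves the line of \<open>v\<close> and
    \<open>P\<close> kills it. Multiplicativity of \<open>\<sigma>\<close> follows from this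
    relation.\<close>
  have intertwine: "\<sigma> g * P = P * \<rho> g" if g: "g \<in> H" for g
  proof -
    have "P * \<rho> g = P * \<rho> g * (I * L + S * P)"
      unfolding one by (rule right_mult_one_mat[OF P\<rho>c[OF g], symmetric])
    also have "\<dots> = P * \<rho> g * (I * L) + P * \<rho> g * (S * P)"
      by (rule mult_add_distrib_mat[OF P\<rho>c[OF g] IL SP])
    also have "P * \<rho> g * (I * L) = P * \<rho> g * I * L"
      by (rule assoc_mult_mat[OF P\<rho>c[OF g] I L, symmetric])
    also have "\<dots> = 0\<^sub>m (d - 1) d" unfolding P\<rho>I[OF g] using L by simp
    also have "P * \<rho> g * (S * P) = \<sigma> g * P"
      unfolding \<sigma>_def by (rule assoc_mult_mat[OF P\<rho>c[OF g] S P, symmetric])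
    finally show ?thesis using \<sigma>_carr[OF g] P by simp
  qed
  have \<sigma>_mult: "\<sigma> (g * h) = \<sigma> g * \<sigma> h" if gh: "g \<in> H" "h \<in> H" for g h
  proof -
    have "\<sigma> (g * h) = P * \<rho> g * \<rho> h * S"
      unfolding \<sigma>_def mult[OF gh] assoc_mult_mat[OF P carr[OF gh(1)] carr[OF gh(2)], symmetric] ..
    also have "\<dots> = \<sigma> g * P * \<rho> h * S" by (simp add: intertwine[OF gh(1)])
    also have "\<sigma> g * P * \<rho> h = \<sigma> g * (P * \<rho> h)"
      by (rule assoc_mult_mat[OF \<sigma>_carr[OF gh(1)] P carr[OF gh(2)]])
    also have "\<dots> * S = \<sigma> g * \<sigma> h"
      unfolding \<sigma>_def[of h] by (rule assoc_mult_mat[OF \<sigma>_carr[OF gh(1)] P\<rho>c[OF gh(2)] S])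
    finally show ?thesis .
  qed
  have \<sigma>_one: "\<sigma> (1\<^sub>m n) = 1\<^sub>m (d - 1)"
    using algebraic_reps_one[OF V H] P PS by (simp add: \<sigma>_def \<rho>_def d_def)
  \<comment> \<open>The value of \<open>\<sigma>\<close> at the inverse of \<open>g\<close> is an
    inverse of \<open>\<sigma> g\<close>, so the determinant cannot vanish.\<close>
  have \<sigma>_GL: "\<sigma> g \<in> carrier (GL (d - 1))" if g: "g \<in> H" for g
  proof -
    have g': "inv\<^bsub>GL n\<^esub> g \<in> H" by (rule subgroup.m_inv_closed[OF H g])
    have "g * inv\<^bsub>GL n\<^esub> g = 1\<^sub>m n"
      using group.r_inv[OF group_GL subgroup.mem_carrier[OF H g]] by simp
    then have "\<sigma> g * \<sigma> (inv\<^bsub>GL n\<^esub> g) = 1\<^sub>m (d - 1)"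
      using \<sigma>_mult[OF g g'] \<sigma>_one by simp
    then have "det (\<sigma> g) * det (\<sigma> (inv\<^bsub>GL n\<^esub> g)) = 1"
      using det_mult[OF \<sigma>_carr[OF g] \<sigma>_carr[OF g']] by simp
    then show ?thesis using \<sigma>_carr[OF g] by (auto simp: carrier_GL_iff)
  qed
  have \<sigma>_regular: "regular_on n H (\<lambda>g. \<sigma> g $$ (i, j))" if "i < d - 1" "j < d - 1" for i j
  proof (rule regular_on_cong)
    show "regular_on n H (\<lambda>g. \<Sum>k<d. (\<Sum>l<d. P $$ (i, l) * \<rho> g $$ (l, k)) * S $$ (k, j))"
      using V unfolding algebraic_reps_def algebraic_hom_def \<rho>_def d_def
      by (intro regular_on_sum regular_on_mult regular_on_const) auto
    fix g assume g: "g \<in> H"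
    show "(\<Sum>k<d. (\<Sum>l<d. P $$ (i, l) * \<rho> g $$ (l, k)) * S $$ (k, j)) = \<sigma> g $$ (i, j)"
      unfolding \<sigma>_def index_mult_mat_sum[OF P\<rho>c[OF g] S that]
      by (intro sum.cong refl) (use that in \<open>simp add: index_mult_mat_sum[OF P carr[OF g]] del: index_mult_mat(1)\<close>)
  qed
  define W where "W = (d - 1, \<sigma>)"
  show thesis
  proof
    show "W \<in> algebraic_reps n H"
      unfolding W_def algebraic_reps_def algebraic_hom_def hom_def
      using \<sigma>_GL \<sigma>_mult \<sigma>_regular by simp
    show "fst W = fst V - 1" by (simp add: W_def d_def)
    have "I \<in> module_homs H (weight_rep m) V"
    proof -
      have "I * mat 1 1 (\<lambda>_. c) = c \<cdot>\<^sub>m I" for c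
        using I by (intro eq_matI) (auto simp: scalar_prod_def)
      then show ?thesis using \<rho>I I by (simp add: module_homs_def weight_rep_def \<rho>_def d_def)
    qed
    moreover have "P \<in> module_homs H V W"
      using P intertwine by (simp add: module_homs_def W_def \<rho>_def d_def)
    moreover have "inj_on (\<lambda>u. I *\<^sub>v u) (carrier_vec 1)"
    proof (rule inj_on_inverseI)
      fix u :: "complex vec" assume u: "u \<in> carrier_vec 1"
      show "L *\<^sub>v (I *\<^sub>v u) = u"
        using assoc_mult_mat_vec[OF L I u] LI u by simp
    qed
    moreover have "(\<lambda>u. I *\<^sub>v u) ` carrier_vec 1 = mat_kernel P"
    proof (intro equalityI subsetI)
      fix x assume "x \<in> (\<lambda>u. I *\<^sub>v u) ` carrier_vec 1"
      then obtain u where u: "u \<in> carrier_vec 1" "x = I *\<^sub>v u" by blast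
      have "P *\<^sub>v x = 0\<^sub>m (d - 1) 1 *\<^sub>v u"
        using assoc_mult_mat_vec[OF P I u(1)] u(2) PI by simp
      also have "\<dots> = 0\<^sub>v (d - 1)" using u(1) by (intro eq_vecI) auto
      finally show "x \<in> mat_kernel P" using I u by (intro mat_kernelI[OF P]) auto
    next
      fix x assume "x \<in> mat_kernel P"
      then have x: "x \<in> carrier_vec d" "P *\<^sub>v x = 0\<^sub>v (d - 1)" using mat_kernelD[OF P] by auto
      have "x = (I * L + S * P) *\<^sub>v x" using x by (simp add: one)
      also have "\<dots> = I * L *\<^sub>v x + S * P *\<^sub>v x" by (rule add_mult_distrib_mat_vec[OF IL SP x(1)])
      also have "S * P *\<^sub>v x = S *\<^sub>v 0\<^sub>v (d - 1)" using assoc_mult_mat_vec[OF S P x(1)] x(2) by simp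
      also have "\<dots> = 0\<^sub>v d" using S by (intro eq_vecI) auto
      also have "I * L *\<^sub>v x = I *\<^sub>v (L *\<^sub>v x)" by (rule assoc_mult_mat_vec[OF I L x(1)])
      also have "I *\<^sub>v (L *\<^sub>v x) + 0\<^sub>v d = I *\<^sub>v (L *\<^sub>v x)"
        by (rule right_zero_vec[OF mult_mat_vec_carrier[OF I mult_mat_vec_carrier[OF L x(1)]]])
      finally show "x \<in> (\<lambda>u. I *\<^sub>v u) ` carrier_vec 1"
        by (rule image_eqI[OF _ mult_mat_vec_carrier[OF L x(1)]])
    qed
    moreover have "(\<lambda>v. P *\<^sub>v v) ` carrier_vec d = carrier_vec (d - 1)"
    proof (intro equalityI subsetI)
      fix w :: "complex vec" assume w: "w \<in> carrier_vec (d - 1)"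
      have "w = P * S *\<^sub>v w" using w by (simp add: PS)
      also have "\<dots> = P *\<^sub>v (S *\<^sub>v w)" by (rule assoc_mult_mat_vec[OF P S w])
      finally show "w \<in> (\<lambda>v. P *\<^sub>v v) ` carrier_vec d"
        by (rule image_eqI[OF _ mult_mat_vec_carrier[OF S w]])
    qed (use P in auto)
    ultimately show "short_exact H (weight_rep m) V W"
      unfolding short_exact_def by (intro bexI[of _ I] bexI[of _ P]) (auto simp: weight_rep_def W_def d_def)
  qed
qed

section \<open>Classes as integral combinations of weights\<close>

abbreviation weights :: "(int \<Rightarrow>\<^sub>0 int) \<Rightarrow> rep \<Rightarrow>\<^sub>0 int" where
  "weights \<equiv> frag_extend (\<lambda>m. frag_of (weight_rep m))"

text \<open>Induction on the dimension: a common eigenvector splits off one weight, and the quotient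
  has dimension one less.\<close>

lemma rep_eq_weights:
  assumes "V \<in> algebraic_reps n H"
  shows "\<exists>c. frag_of V - weights c \<in> exact_relations n H"
  using assms
proof (induction "fst V" arbitrary: V)
  case 0
  \<comment> \<open>For the zero module this sequence yields the relation
    \<open>V - (V + V) = - V\<close>, so its class vanishes.\<close>
  have "short_exact H V V V"
    unfolding short_exact_def
  proof (intro bexI conjI)
    let ?O = "0\<^sub>m 0 0 :: complex mat"
    have dims: "dim_row (snd V g) = 0" "dim_col (snd V g) = 0" if "g \<in> H" for g
      using algebraic_repsD[OF 0(2) that] 0(1) by auto
    have zero_vec: "carrier_vec 0 = {vNil :: complex vec}" "?O *\<^sub>v vNil = vNil"
      by (auto intro!: eq_vecI)
    show "?O \<in> module_homs H V V"
      using 0(1) dims by (auto simp: module_homs_def intro!: eq_matI)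
    show "?O \<in> module_homs H V V"
      using 0(1) dims by (auto simp: module_homs_def intro!: eq_matI)
    show "inj_on (\<lambda>u. ?O *\<^sub>v u) (carrier_vec (fst V))"
      using 0(1) by (auto intro!: inj_onI)
    have im: "(\<lambda>u. ?O *\<^sub>v u) ` carrier_vec (fst V) = carrier_vec (fst V)"
      unfolding 0(1)[symmetric] zero_vec(1) by (simp add: zero_vec(2))
    then show "(\<lambda>u. ?O *\<^sub>v u) ` carrier_vec (fst V) = mat_kernel ?O"
      unfolding 0(1)[symmetric] mat_kernel_def by (auto simp: zero_vec)
    show "(\<lambda>u. ?O *\<^sub>v u) ` carrier_vec (fst V) = carrier_vec (fst V)" by (rule im)
  qed
  from exact_relations_minus[OF exact_relations_incl[OF 0(2,2,2) this]]
  show ?case by (intro exI[of _ 0]) simp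
next
  case (Suc d)
  obtain m v where v: "v \<in> carrier_vec (fst V)" "v \<noteq> 0\<^sub>v (fst V)"
    "\<And>g. g \<in> H \<Longrightarrow> snd V g *\<^sub>v v = (\<chi> g powi m) \<cdot>\<^sub>v v"
    using common_eigenvector[OF Suc(3)] Suc(2) by (metis zero_less_Suc)
  obtain W where W: "W \<in> algebraic_reps n H" "fst W = fst V - 1" "short_exact H (weight_rep m) V W"
    using quotient_by_eigenvector[OF Suc(3) v] by blast
  have "d = fst W" using W(2) Suc(2)[symmetric] by simp
  from Suc(1)[OF this W(1)] obtain c where c: "frag_of W - weights c \<in> exact_relations n H" ..
  have "frag_of V - weights (frag_of m + c) =
      (frag_of V - (frag_of (weight_rep m) + frag_of W)) + (frag_of W - weights c)"
    by (simp add: frag_extend_add)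
  also have "\<dots> \<in> exact_relations n H"
    by (rule exact_relations_add[OF exact_relations_incl[OF weight_rep_algebraic Suc(3) W(1,3)] c])
  finally show ?case ..
qed

lemma frag_eq_weights:
  assumes "Poly_Mapping.keys x \<subseteq> algebraic_reps n H"
  shows "\<exists>c. x - weights c \<in> exact_relations n H"
  using assms
proof (induction x rule: frag_induction)
  case zero
  show ?case using exact_relations_zero by (intro exI[of _ 0]) simp
next
  case (one V)
  then show ?case by (rule rep_eq_weights)
next
  case (diff x y)
  then obtain c e where "x - weights c \<in> exact_relations n H" "y - weights e \<in> exact_relations n H"
    by blast
  then have "(x - weights c) - (y - weights e) \<in> exact_relations n H"
    by (rule exact_relations_diff)
  then show ?case by (intro exI[of _ "c - e"]) (simp add: frag_extend_diff algebra_simps)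
qed

lemma weights_eval: "frag_eval (\<lambda>V. mat_trace (snd V g)) (weights c) = frag_eval (\<lambda>m. \<chi> g powi m) c"
  by (simp add: frag_eval_extend mat_trace_weight_rep)

text \<open>The normal form on which the comparison of \<open>G_k\<close> and \<open>T\<close>
  rests: in both cases the characters are the integral Laurent polynomials in
  \<open>\<chi>\<close>.\<close>

lemma carrier_character_ring:
  "carrier (character_ring n H) = range (\<lambda>c. \<lambda>g\<in>H. frag_eval (\<lambda>m. \<chi> g powi m) c)"
proof -
  have "virtual_character H x \<in> range (\<lambda>c. \<lambda>g\<in>H. frag_eval (\<lambda>m. \<chi> g powi m) c)"
    if x: "Poly_Mapping.keys x \<subseteq> algebraic_reps n H" for x
  proof -
    obtain c where c: "x - weights c \<in> exact_relations n H" using frag_eq_weights[OF x] by blast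
    have "frag_eval (\<lambda>V. mat_trace (snd V g)) x = frag_eval (\<lambda>m. \<chi> g powi m) c" if "g \<in> H" for g
      using frag_eval_exact_relations[OF c that] by (simp add: frag_eval_diff weights_eval)
    then have "virtual_character H x = (\<lambda>g\<in>H. frag_eval (\<lambda>m. \<chi> g powi m) c)"
      unfolding virtual_character_eq by (intro restrict_ext) simp
    then show ?thesis by blast
  qed
  moreover have "(\<lambda>g\<in>H. frag_eval (\<lambda>m. \<chi> g powi m) c) \<in>
      virtual_character H ` {x. Poly_Mapping.keys x \<subseteq> algebraic_reps n H}" for c
  proof (rule image_eqI)
    show "(\<lambda>g\<in>H. frag_eval (\<lambda>m. \<chi> g powi m) c) = virtual_character H (weights c)"
      by (simp add: virtual_character_eq weights_eval)
    show "weights c \<in> {x. Poly_Mapping.keys x \<subseteq> algebraic_reps n H}"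
      using keys_frag_extend[of "\<lambda>m. frag_of (weight_rep m)" c] weight_rep_algebraic by fastforce
  qed
  ultimately show ?thesis by (auto simp: character_ring_def character_image)
qed

text \<open>By \<open>\<tau>\<close> the character takes every nonzero value, so the Laurent
  polynomial is determined by its values on \<open>H\<close>.\<close>

lemma weights_unique:
  assumes "\<And>g. g \<in> H \<Longrightarrow> frag_eval (\<lambda>m. \<chi> g powi m) c = frag_eval (\<lambda>m. \<chi> g powi m) e"
  shows "c = e"
proof -
  have "frag_eval (\<lambda>m. z powi m) (c - e) = 0" if "z \<noteq> 0" for z
    using assms[OF \<tau>_mem[OF that]] that by (simp add: \<chi>_\<tau> frag_eval_diff)
  then have "c - e = 0" by (rule frag_eval_power_int_eq_0)
  then show ?thesis by simp
qed

text \<open>Modulo the relations both classes are sums of weights. Equal characters force equal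
  weights, and the difference of the representatives becomes a relation.\<close>

lemma inj_on_character: "inj_on (character H) (carrier (rep_ring n H))"
proof (rule inj_onI)
  fix X Y assume XY: "X \<in> carrier (rep_ring n H)" "Y \<in> carrier (rep_ring n H)"
    and eq: "character H X = character H Y"
  obtain x y where x: "Poly_Mapping.keys x \<subseteq> algebraic_reps n H" "X = (\<lambda>i. i + x) ` exact_relations n H"
    and y: "Poly_Mapping.keys y \<subseteq> algebraic_reps n H" "Y = (\<lambda>i. i + y) ` exact_relations n H"
    using XY by (auto simp: carrier_rep_ring_iff)
  obtain c where c: "x - weights c \<in> exact_relations n H" using frag_eq_weights[OF x(1)] by blast
  obtain e where e: "y - weights e \<in> exact_relations n H" using frag_eq_weights[OF y(1)] by blast
  have vc_eq: "virtual_character H x = virtual_character H y"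
    using eq by (simp add: x(2) y(2) character_coset)
  have vc: "frag_eval (\<lambda>V. mat_trace (snd V g)) x = frag_eval (\<lambda>V. mat_trace (snd V g)) y"
    if "g \<in> H" for g
    using arg_cong[OF vc_eq, of "\<lambda>f. f g"] that by (simp add: virtual_character_eq)
  have "c = e"
  proof (rule weights_unique)
    fix g assume g: "g \<in> H"
    show "frag_eval (\<lambda>m. \<chi> g powi m) c = frag_eval (\<lambda>m. \<chi> g powi m) e"
      using frag_eval_exact_relations[OF c g] frag_eval_exact_relations[OF e g] vc[OF g]
      by (simp add: frag_eval_diff weights_eval)
  qed
  then have d: "x - y \<in> exact_relations n H" using exact_relations_diff[OF c e] by simp
  have "i + x \<in> Y" if "i \<in> exact_relations n H" for i
    unfolding y(2) using exact_relations_add[OF that d] by (intro image_eqI[of _ _ "i + (x - y)"]) auto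
  moreover have "i + y \<in> X" if "i \<in> exact_relations n H" for i
    unfolding x(2) using exact_relations_diff[OF that d] by (intro image_eqI[of _ _ "i - (x - y)"]) auto
  ultimately show "X = Y" using x(2) y(2) by blast
qed

end

section \<open>The group of jet reparametrizations\<close>

text \<open>The powers \<open>A ^ Suc i\<close> are matched as they stand below; both rules would unfold them.\<close>

declare power_Suc [simp del] class_semiring.nat_pow_Suc [simp del]

text \<open>Row \<open>i\<close> holds \<open>A^(i+1)\<close> modulo \<open>t^(k+1)\<close>. On row
  vectors of coefficients this is the substitution of \<open>A\<close> into series without constant
  term, which turns matrix products into compositions.\<close>

definition jet_mat :: "nat \<Rightarrow> complex fps \<Rightarrow> complex mat" where
  "jet_mat k A = mat k k (\<lambda>(i, j). fps_nth (A ^ Suc i) (Suc j))"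

lemma jet_mat_carrier: "jet_mat k A \<in> carrier_mat k k"
  by (simp add: jet_mat_def)

lemma jet_mat_index: "i < k \<Longrightarrow> j < k \<Longrightarrow> jet_mat k A $$ (i, j) = fps_nth (A ^ Suc i) (Suc j)"
  by (simp add: jet_mat_def)

text \<open>The general formula for powers also sums over lists with zero entries; those terms
  vanish because \<open>A\<close> has no constant term.\<close>

lemma fps_power_Suc_nth_lists:
  assumes "fps_nth A 0 = (0 :: complex)"
  shows "fps_nth (A ^ Suc i) n =
    (\<Sum>s | length s = Suc i \<and> sum_list s = n \<and> (\<forall>m \<in> set s. 1 \<le> m). prod_list (map (fps_nth A) s))"
proof -
  let ?S = "{s. length s = Suc i \<and> sum_list s = n \<and> (\<forall>m \<in> set s. 1 \<le> m)}"
  have "fps_nth (A ^ Suc i) n = (\<Sum>v\<in>natpermute n (Suc i). prod_list (map (fps_nth A) v))"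
    unfolding fps_power_nth_Suc Suc_eq_plus1[symmetric]
    by (intro sum.cong refl)
      (auto simp: natpermute_def prod.list_conv_set_nth atLeast0AtMost lessThan_Suc_atMost
        atLeast0LessThan simp del: prod.atMost_Suc prod.lessThan_Suc intro!: prod.cong)
  also have "\<dots> = (\<Sum>v\<in>?S. prod_list (map (fps_nth A) v))"
  proof (rule sum.mono_neutral_right)
    show "finite (natpermute n (Suc i))" by (rule natpermute_finite)
    show "?S \<subseteq> natpermute n (Suc i)" by (auto simp: natpermute_def)
    show "\<forall>v \<in> natpermute n (Suc i) - ?S. prod_list (map (fps_nth A) v) = 0"
    proof
      fix v assume "v \<in> natpermute n (Suc i) - ?S"
      then have "0 \<in> set v" by (auto simp: natpermute_def not_le)
      then show "prod_list (map (fps_nth A) v) = 0"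
        using assms by force
    qed
  qed
  finally show ?thesis .
qed

text \<open>The sums in \<open>reparam_mat\<close> read \<open>a\<close> only at positive indices,
  so \<open>a 0\<close> may be replaced by the constant term \<open>0\<close>.\<close>

lemma reparam_mat_eq_jet_mat:
  "reparam_mat k a = jet_mat k (Abs_fps (\<lambda>n. if n = 0 then 0 else a n))"
proof (rule eq_matI)
  let ?A = "Abs_fps (\<lambda>n. if n = 0 then 0 else a n)"
  fix i j assume "i < dim_row (jet_mat k ?A)" "j < dim_col (jet_mat k ?A)"
  then have ij: "i < k" "j < k" by (simp_all add: jet_mat_def)
  have "prod_list (map (fps_nth ?A) s) = prod_list (map a s)" if "\<forall>m\<in>set s. 1 \<le> m" for s
    using that by (intro arg_cong[of _ _ prod_list] map_cong refl) auto
  then show "reparam_mat k a $$ (i, j) = jet_mat k ?A $$ (i, j)"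
    using ij by (auto simp: reparam_mat_def jet_mat_index fps_power_Suc_nth_lists
         intro!: sum.cong)
qed (simp_all add: reparam_mat_def jet_mat_def)

lemma reparam_group_eq: "reparam_group k = {jet_mat k A | A. fps_nth A 0 = 0 \<and> fps_nth A 1 \<noteq> 0}"
proof (intro equalityI subsetI)
  fix g assume "g \<in> reparam_group k"
  then obtain a where "g = reparam_mat k a" "a 1 \<noteq> 0" by (auto simp: reparam_group_def)
  then show "g \<in> {jet_mat k A | A. fps_nth A 0 = 0 \<and> fps_nth A 1 \<noteq> 0}"
    unfolding reparam_mat_eq_jet_mat by fastforce
next
  fix g assume "g \<in> {jet_mat k A | A. fps_nth A 0 = 0 \<and> fps_nth A 1 \<noteq> 0}"
  then obtain A where A: "g = jet_mat k A" "fps_nth A 0 = 0" "fps_nth A 1 \<noteq> 0" by blast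
  have "Abs_fps (\<lambda>n. if n = 0 then 0 else fps_nth A n) = A"
    by (rule fps_ext) (simp add: A(2))
  then have "g = reparam_mat k (fps_nth A)" by (simp add: reparam_mat_eq_jet_mat A(1))
  then show "g \<in> reparam_group k" using A(3) unfolding reparam_group_def by blast
qed

lemma reparam_groupE:
  assumes "g \<in> reparam_group k"
  obtains A where "g = jet_mat k A" "fps_nth A 0 = 0" "fps_nth A 1 \<noteq> 0"
  using assms unfolding reparam_group_eq by blast

lemma jet_mat_mult:
  assumes "fps_nth A 0 = 0" "fps_nth B 0 = 0"
  shows "jet_mat k A * jet_mat k B = jet_mat k (A oo B)"
proof (rule eq_matI)
  fix i j assume "i < dim_row (jet_mat k (A oo B))" "j < dim_col (jet_mat k (A oo B))"
  then have ij: "i < k" "j < k" by (simp_all add: jet_mat_def)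
  let ?t = "\<lambda>m. fps_nth (A ^ Suc i) m * fps_nth (B ^ m) (Suc j)"
  have "(jet_mat k A * jet_mat k B) $$ (i, j) = (\<Sum>l<k. ?t (Suc l))"
    unfolding index_mult_mat_sum[OF jet_mat_carrier jet_mat_carrier ij]
    using ij by (intro sum.cong refl) (simp add: jet_mat_index)
  \<comment> \<open>The power \<open>B^(l+1)\<close> starts at \<open>t^(l+1)\<close> and has no
    coefficient at \<open>t^(j+1)\<close> when \<open>l\<close> exceeds \<open>j\<close>.\<close>
  also have "\<dots> = (\<Sum>l<Suc j. ?t (Suc l))"
    using ij by (intro sum.mono_neutral_right)
      (auto simp: startsby_zero_power_prefix[OF assms(2)] )
  \<comment> \<open>The added term \<open>m = 0\<close> vanishes since \<open>A^(i+1)\<close> has no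
    constant term; with it the sum is the coefficient of a composition.\<close>
  also have "\<dots> = (\<Sum>m<Suc (Suc j). ?t m)"
    by (subst sum.lessThan_Suc_shift[of ?t]) (simp add: startsby_zero_power assms(1))
  also have "\<dots> = fps_nth ((A oo B) ^ Suc i) (Suc j)"
    unfolding fps_compose_power[OF assms(2)] fps_compose_nth
    by (simp add: atLeast0AtMost lessThan_Suc_atMost  del: sum.lessThan_Suc sum.atMost_Suc)
  finally show "(jet_mat k A * jet_mat k B) $$ (i, j) = jet_mat k (A oo B) $$ (i, j)"
    using ij by (simp add: jet_mat_index)
qed (simp_all add: jet_mat_def)

lemma jet_mat_X: "jet_mat k fps_X = 1\<^sub>m k"
  by (rule eq_matI) (auto simp: jet_mat_def )

lemma jet_mat_lower: "fps_nth A 0 = 0 \<Longrightarrow> i < k \<Longrightarrow> j < i \<Longrightarrow> jet_mat k A $$ (i, j) = 0"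
  by (simp add: jet_mat_index startsby_zero_power_prefix)

lemma jet_mat_diag: "fps_nth A 0 = 0 \<Longrightarrow> i < k \<Longrightarrow> jet_mat k A $$ (i, i) = (fps_nth A 1) ^ Suc i"
  by (simp add: jet_mat_index startsby_zero_power_nth_same)

lemma det_jet_mat:
  assumes "fps_nth A 0 = 0"
  shows "det (jet_mat k A) = (\<Prod>i<k. jet_mat k A $$ (i, i))"
    and "det (jet_mat k A) = (fps_nth A 1) ^ (\<Sum>i<k. Suc i)"
proof -
  have "upper_triangular (jet_mat k A)"
    using jet_mat_lower[OF assms] by (intro upper_triangularI) (simp add: jet_mat_def)
  from det_upper_triangular[OF this jet_mat_carrier]
  show *: "det (jet_mat k A) = (\<Prod>i<k. jet_mat k A $$ (i, i))"
    unfolding prod_list_diag_prod by (simp add: jet_mat_def atLeast0LessThan)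
  then show "det (jet_mat k A) = (fps_nth A 1) ^ (\<Sum>i<k. Suc i)"
    using assms by (simp add: jet_mat_diag power_sum)
qed

lemma subgroup_reparam_group: "subgroup (reparam_group k) (GL k)"
proof
  have GL: "jet_mat k A \<in> carrier (GL k)" if "fps_nth A 0 = 0" "fps_nth A 1 \<noteq> 0" for A
    unfolding carrier_GL_iff using det_jet_mat(2)[OF that(1)] that(2) jet_mat_carrier by simp
  show "reparam_group k \<subseteq> carrier (GL k)"
    using GL by (auto simp: reparam_group_eq)
  show "x \<otimes>\<^bsub>GL k\<^esub> y \<in> reparam_group k" if "x \<in> reparam_group k" "y \<in> reparam_group k" for x y
  proof -
    obtain A B where A: "x = jet_mat k A" "fps_nth A 0 = 0" "fps_nth A 1 \<noteq> 0"
      and B: "y = jet_mat k B" "fps_nth B 0 = 0" "fps_nth B 1 \<noteq> 0"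
      using \<open>x \<in> reparam_group k\<close> \<open>y \<in> reparam_group k\<close> by (meson reparam_groupE)
    have "x \<otimes>\<^bsub>GL k\<^esub> y = jet_mat k (A oo B)" using jet_mat_mult A B by simp
    moreover have "fps_nth (A oo B) 0 = 0" "fps_nth (A oo B) 1 \<noteq> 0"
      using A B by (simp_all add: fps_compose_nth)
    ultimately show ?thesis unfolding reparam_group_eq by blast
  qed
  show "\<one>\<^bsub>GL k\<^esub> \<in> reparam_group k"
    unfolding reparam_group_eq by (auto intro!: exI[of _ fps_X] simp: jet_mat_X)
  show "inv\<^bsub>GL k\<^esub> x \<in> reparam_group k" if "x \<in> reparam_group k" for x
  proof -
    obtain A where A: "x = jet_mat k A" "fps_nth A 0 = 0" "fps_nth A 1 \<noteq> 0"
      using \<open>x \<in> reparam_group k\<close> by (rule reparam_groupE)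
    \<comment> \<open>The inverse matrix comes from the compositional inverse, which again has no
      constant term and a nonzero linear coefficient.\<close>
    have B: "fps_nth (fps_inv A) 0 = 0" "fps_nth (fps_inv A) 1 \<noteq> 0"
      using A(3) by (simp_all add: fps_inv_def)
    have "inv\<^bsub>GL k\<^esub> x = jet_mat k (fps_inv A)"
      using jet_mat_mult[OF B(1) A(2)] fps_inv[OF A(2,3)]
        GL[OF A(2,3)] GL[OF B]
      by (intro group.inv_equality[OF group_GL]) (simp_all only: A(1) jet_mat_X mult_GL one_GL)
    with B show ?thesis unfolding reparam_group_eq by blast
  qed
qed

definition jet_character :: "complex mat \<Rightarrow> complex" where
  "jet_character g = g $$ (0, 0)"

lemma jet_character_jet_mat: "0 < k \<Longrightarrow> jet_character (jet_mat k A) = fps_nth A 1"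
  by (simp add: jet_character_def jet_mat_index)

text \<open>The chain rule at the common fixed point \<open>0\<close>.\<close>

lemma jet_character_mult:
  assumes "0 < k" "g \<in> reparam_group k" "h \<in> reparam_group k"
  shows "jet_character (g * h) = jet_character g * jet_character h"
proof -
  obtain A B where "g = jet_mat k A" "fps_nth A 0 = 0" "h = jet_mat k B" "fps_nth B 0 = 0"
    using assms(2,3) by (meson reparam_groupE)
  then show ?thesis
    using assms(1) by (simp add: jet_mat_mult jet_character_jet_mat fps_compose_nth)
qed

lemma jet_character_nonzero: "0 < k \<Longrightarrow> g \<in> reparam_group k \<Longrightarrow> jet_character g \<noteq> 0"
  by (auto elim!: reparam_groupE simp: jet_character_jet_mat)

lemma regular_on_jet_character: "0 < k \<Longrightarrow> regular_on k H jet_character"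
  unfolding jet_character_def by (rule regular_on_entry)

lemma det_reparam_group:
  assumes "0 < k" "g \<in> reparam_group k"
  shows "det g = (\<Prod>i<k. g $$ (i, i))" "det g = jet_character g ^ (\<Sum>i<k. Suc i)"
proof -
  obtain A where "g = jet_mat k A" "fps_nth A 0 = 0"
    using assms(2) by (rule reparam_groupE)
  then show "det g = (\<Prod>i<k. g $$ (i, i))" "det g = jet_character g ^ (\<Sum>i<k. Suc i)"
    using assms(1) det_jet_mat[of A k] by (simp_all only: jet_character_jet_mat)
qed

text \<open>The determinant is the product of the diagonal, whose first entry is the character.
  Dividing it out expresses the inverse by the inverse determinant and the other diagonal
  entries.\<close>

lemma regular_on_inverse_jet_character:
  assumes "0 < k" "H \<subseteq> reparam_group k"
  shows "regular_on k H (\<lambda>g. inverse (jet_character g))"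
proof (rule regular_on_cong)
  show "regular_on k H (\<lambda>g. inverse (det g) * (\<Prod>i\<in>{1..<k}. g $$ (i, i)))"
    by (intro regular_on_mult regular_on_inv_det regular_on_prod regular_on_entry) auto
  fix g assume "g \<in> H"
  with assms have g: "g \<in> reparam_group k" by blast
  have "{..<k} = insert 0 {1..<k}" using assms(1) by auto
  then have "det g = jet_character g * (\<Prod>i\<in>{1..<k}. g $$ (i, i))"
    unfolding det_reparam_group(1)[OF assms(1) g] jet_character_def by simp
  moreover have "det g \<noteq> 0"
    using subgroup.mem_carrier[OF subgroup_reparam_group g] by (simp add: carrier_GL_iff)
  ultimately show "inverse (det g) * (\<Prod>i\<in>{1..<k}. g $$ (i, i)) = inverse (jet_character g)"
    by (auto simp: field_simps)
qed

text \<open>Along a section of the character the determinant is a pure power of \<open>a\<close>, so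
  its inverse is a Laurent polynomial as well.\<close>

lemma laurentfun_section:
  assumes k: "0 < k" and f: "f \<in> regular_functions k"
    and \<gamma>: "\<And>a. a \<noteq> 0 \<Longrightarrow> \<gamma> a \<in> reparam_group k" "\<And>a. a \<noteq> 0 \<Longrightarrow> jet_character (\<gamma> a) = a"
    and "\<And>i j. i < k \<Longrightarrow> j < k \<Longrightarrow> laurentfun (\<lambda>a. \<gamma> a $$ (i, j))"
  shows "laurentfun (\<lambda>a. f (\<gamma> a))"
proof (rule laurentfun_regular[OF f])
  show "laurentfun (\<lambda>a. inverse (det (\<gamma> a)))"
    by (rule laurentfun_cong[OF laurentfun_inverse_power[of "\<Sum>i<k. Suc i"]])
      (simp add: det_reparam_group(2)[OF k \<gamma>(1)] \<gamma>(2))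
qed (fact assms)

section \<open>The scalings and the contraction onto them\<close>

definition diag_jet :: "nat \<Rightarrow> complex \<Rightarrow> complex mat" where
  "diag_jet k a = jet_mat k (fps_const a * fps_X)"

lemma diag_jet_mem: "a \<noteq> 0 \<Longrightarrow> diag_jet k a \<in> reparam_group k"
  unfolding diag_jet_def reparam_group_eq by (auto intro!: exI[of _ "fps_const a * fps_X"])

lemma diag_jet_index:
  "i < k \<Longrightarrow> j < k \<Longrightarrow> diag_jet k a $$ (i, j) = (if i = j then a ^ Suc i else 0)"
  by (auto simp: diag_jet_def jet_mat_index power_mult_distrib
      )

lemma diag_jet_mult: "diag_jet k (a * b) = diag_jet k a * diag_jet k b"
proof -
  have "fps_const a * fps_X oo fps_const b * fps_X = fps_const (a * b) * (fps_X :: complex fps)"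
    by (subst fps_compose_mult_distrib) (simp_all add: mult.assoc[symmetric])
  then show ?thesis by (simp add: diag_jet_def jet_mat_mult)
qed

lemma jet_character_diag_jet: "0 < k \<Longrightarrow> jet_character (diag_jet k a) = a"
  by (simp add: diag_jet_def jet_character_jet_mat)

text \<open>If \<open>g\<close> is given by \<open>A\<close>, its conjugate is
  \<open>A (b t) / b\<close>. With \<open>A = t C(t)\<close> this equals \<open>t C(b t)\<close>,
  which has no denominator and becomes the scaling \<open>a_1 t\<close> at
  \<open>b = 0\<close>.\<close>

lemma contracted_reparam_group:
  assumes k: "0 < k"
  shows "contracted_group k (reparam_group k) jet_character (diag_jet k)"
proof (rule contracted_group.intro)
  fix f assume f: "f \<in> regular_functions k"
  show "laurentfun (\<lambda>a. f (diag_jet k a))"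
  proof (rule laurentfun_section[OF k f])
    fix i j assume ij: "i < k" "j < k"
    have "polyfun (\<lambda>a. diag_jet k a $$ (i, j))"
      using polyfun_power[OF polyfun_id] polyfun_const[of 0] ij
      by (cases "i = j") (simp_all add: diag_jet_index)
    then show "laurentfun (\<lambda>a. diag_jet k a $$ (i, j))" by (rule polyfun_imp_laurentfun)
  qed (simp_all add: diag_jet_mem jet_character_diag_jet k)
next
  fix g assume "g \<in> reparam_group k"
  then obtain A where A: "g = jet_mat k A" "fps_nth A 0 = 0" "fps_nth A 1 \<noteq> 0" by (rule reparam_groupE)
  define C where "C = fps_shift 1 A"
  have AC: "A = fps_X * C"
    by (rule fps_ext) (simp add: C_def A(2))
  define B where "B b = fps_X * (C oo (fps_const b * fps_X))" for b
  have B: "fps_nth (B b) 0 = 0" "fps_nth (B b) 1 = fps_nth A 1" for b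
    by (simp_all add: B_def AC)
  have entry: "jet_mat k (B b) $$ (i, j) = (if j < i then 0 else b ^ (j - i) * fps_nth (C ^ Suc i) (j - i))"
    if "i < k" "j < k" for b i j
  proof -
    have "B b ^ Suc i = fps_X ^ Suc i * (C ^ Suc i oo (fps_const b * fps_X))"
      unfolding B_def power_mult_distrib by (subst fps_compose_power) simp_all
    then show ?thesis
      using that by (simp add: jet_mat_index fps_X_power_mult_nth fps_compose_linear)
  qed
  show "\<exists>M. (\<forall>b. M b \<in> reparam_group k) \<and>
      (\<forall>b. b \<noteq> 0 \<longrightarrow> g * diag_jet k b = diag_jet k b * M b) \<and>
      M 0 = diag_jet k (jet_character g) \<and> (\<forall>f \<in> regular_functions k. polyfun (\<lambda>b. f (M b)))"
  proof (intro exI[of _ "\<lambda>b. jet_mat k (B b)"] conjI allI impI ballI)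
    show "jet_mat k (B b) \<in> reparam_group k" for b
      unfolding reparam_group_eq using B A(3) by auto
    show "g * diag_jet k b = diag_jet k b * jet_mat k (B b)" for b
    proof -
      have "A oo (fps_const b * fps_X) = fps_const b * B b"
        unfolding AC B_def by (subst fps_compose_mult_distrib) (simp_all add: mult.assoc)
      moreover have "(fps_const b * fps_X) oo B b = fps_const b * B b"
        using B(1) by (subst fps_compose_mult_distrib) simp_all
      ultimately show ?thesis by (simp add: A diag_jet_def jet_mat_mult B)
    qed
    have "B 0 = fps_const (fps_nth A 1) * fps_X"
      by (simp add: B_def AC mult.commute)
    then show "jet_mat k (B 0) = diag_jet k (jet_character g)"
      by (simp add: A(1) diag_jet_def jet_character_jet_mat k)
    fix f assume f: "f \<in> regular_functions k"
    show "polyfun (\<lambda>b. f (jet_mat k (B b)))"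
    proof (rule regular_functions_comp[OF f, of polyfun])
      fix i j assume ij: "i < k" "j < k"
      show "polyfun (\<lambda>b. jet_mat k (B b) $$ (i, j))"
        unfolding entry[OF ij]
        by (cases "j < i") (auto intro!: polyfun_mult polyfun_power polyfun_id polyfun_const)
    next
      \<comment> \<open>The linear coefficient of \<open>B b\<close> does not depend on
        \<open>b\<close>, so the determinant is constant along the family.\<close>
      show "polyfun (\<lambda>b. inverse (det (jet_mat k (B b))))"
        unfolding det_jet_mat(2)[OF B(1)] B(2) by (rule polyfun_const)
    qed (auto intro: polyfun_const polyfun_add polyfun_mult)
  qed
qed (use k in \<open>auto simp: subgroup_reparam_group regular_on_jet_character
      regular_on_inverse_jet_character jet_character_mult jet_character_nonzero diag_jet_mem
      jet_character_diag_jet diag_jet_mult\<close>)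

text \<open>On the first superdiagonal of \<open>g\<close> that could be nonzero, the
  \<open>N\<close>-th power has \<open>N\<close> times the entry of \<open>g\<close>. In
  characteristic zero that entry must vanish.\<close>

lemma finite_order_unipotent:
  assumes g: "g \<in> reparam_group k" and k: "0 < k" and \<chi>: "jet_character g = 1"
    and N: "0 < N" "g ^\<^sub>m N = 1\<^sub>m k"
  shows "g = 1\<^sub>m k"
proof -
  obtain A where A: "g = jet_mat k A" "fps_nth A 0 = 0" "fps_nth A 1 \<noteq> 0"
    using g by (rule reparam_groupE)
  have carr: "g \<in> carrier_mat k k" by (simp add: A(1) jet_mat_carrier)
  have "fps_nth A 1 = 1" using \<chi> k by (simp add: A(1) jet_character_jet_mat)
  then have low: "g $$ (i, j) = of_bool (i = j)" if "i < k" "j \<le> i" for i j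
    using that jet_mat_lower[OF A(2)] jet_mat_diag[OF A(2)] by (cases "i = j") (auto simp: A(1))
  \<comment> \<open>Induction on the width of the band above the diagonal in which \<open>g\<close>
    is already known to agree with the identity.\<close>
  have "\<forall>i<k. \<forall>j<k. j < i + Suc s \<longrightarrow> g $$ (i, j) = of_bool (i = j)" for s
  proof (induction s)
    case 0
    then show ?case using low by simp
  next
    case (Suc s)
    define t where "t = Suc s"
    have IH: "g $$ (i, j) = of_bool (i = j)" if "i < k" "j < k" "j < i + t" for i j
      using Suc that by (simp add: t_def)
    \<comment> \<open>Below offset \<open>t\<close> the powers agree with the identity, so at offset
      \<open>t\<close> only the two terms \<open>l = i\<close> and \<open>l = j\<close> of the
      matrix product survive and the entries add up.\<close>
    have pow: "\<forall>i<k. \<forall>j<k. (j < i + t \<longrightarrow> (g ^\<^sub>m M) $$ (i, j) = of_bool (i = j)) \<and>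
        (j = i + t \<longrightarrow> (g ^\<^sub>m M) $$ (i, j) = of_nat M * g $$ (i, j))" for M
    proof (induction M)
      case 0
      show ?case using carr by (auto simp: t_def)
    next
      case (Suc M)
      have pc: "g ^\<^sub>m M \<in> carrier_mat k k" using carr by simp
      have step: "(g ^\<^sub>m Suc M) $$ (i, j) =
          g $$ (i, j) + (if j = i + t then (g ^\<^sub>m M) $$ (i, j) else 0)"
        if ij: "i < k" "j < k" "j \<le> i + t" for i j
      proof -
        have "(g ^\<^sub>m Suc M) $$ (i, j) = (\<Sum>l<k. (g ^\<^sub>m M) $$ (i, l) * g $$ (l, j))"
          using index_mult_mat_sum[OF pc carr ij(1,2)] by simp
        also have "\<dots> = (\<Sum>l<k. (if l = i then g $$ (i, j) else 0) +
            (if l = j then (if j = i + t then (g ^\<^sub>m M) $$ (i, j) else 0) else 0))"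
        proof (intro sum.cong refl)
          fix l assume "l \<in> {..<k}"
          then have l: "l < k" by simp
          show "(g ^\<^sub>m M) $$ (i, l) * g $$ (l, j) = (if l = i then g $$ (i, j) else 0) +
            (if l = j then (if j = i + t then (g ^\<^sub>m M) $$ (i, j) else 0) else 0)"
          proof (cases "l < i + t")
            case True
            then show ?thesis using Suc ij(1) l by auto
          next
            case False
            then have "g $$ (l, j) = of_bool (l = j)" "l \<noteq> i"
              using IH[OF l ij(2)] ij(3) by (auto simp: t_def)
            then show ?thesis using False ij(3) by auto
          qed
        qed
        also have "\<dots> = g $$ (i, j) + (if j = i + t then (g ^\<^sub>m M) $$ (i, j) else 0)"
          using ij by (simp add: sum.distrib)
        finally show ?thesis .
      qed
      show ?case
      proof (intro allI impI conjI)
        fix i j assume ij: "i < k" "j < k"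
        show "(g ^\<^sub>m Suc M) $$ (i, j) = of_bool (i = j)" if "j < i + t"
          using step[OF ij] IH[OF ij] that by simp
        show "(g ^\<^sub>m Suc M) $$ (i, j) = of_nat (Suc M) * g $$ (i, j)" if "j = i + t"
          using step[OF ij] Suc ij that by (simp add: algebra_simps)
      qed
    qed
    have "g $$ (i, j) = 0" if "i < k" "j < k" "j = i + t" for i j
    proof -
      have "of_nat N * g $$ (i, j) = (1\<^sub>m k :: complex mat) $$ (i, j)"
        using pow[of N] that N(2) by metis
      then show ?thesis using that N(1) by (simp add: t_def)
    qed
    then have "g $$ (i, j) = of_bool (i = j)" if "i < k" "j < k" "j < i + Suc t" for i j
      using IH[OF that(1,2)] that by (cases "j = i + t") (auto simp: t_def)
    then show ?case unfolding t_def by blast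
  qed
  from this[of k] show ?thesis using carr by (intro eq_matI) auto
qed

section \<open>Tori of the group of jet reparametrizations\<close>

lemma diag_jet_one: "diag_jet k 1 = 1\<^sub>m k"
  by (simp add: diag_jet_def jet_mat_X)

lemma subgroup_diag_jets: "subgroup (diag_jet k ` (UNIV - {0})) (GL k)"
proof (rule group.subgroupI[OF group_GL])
  have GL: "diag_jet k a \<in> carrier (GL k)" if "a \<noteq> 0" for a
    by (rule subgroup.mem_carrier[OF subgroup_reparam_group diag_jet_mem[OF that]])
  show "diag_jet k ` (UNIV - {0}) \<subseteq> carrier (GL k)" using GL by auto
  show "diag_jet k ` (UNIV - {0}) \<noteq> {}" by (auto intro: exI[of _ 1])
  fix x assume "x \<in> diag_jet k ` (UNIV - {0})"
  then obtain a where a: "x = diag_jet k a" "a \<noteq> 0" by auto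
  have "inv\<^bsub>GL k\<^esub> x = diag_jet k (inverse a)"
    using a GL[OF a(2)] GL[of "inverse a"]
    by (intro group.inv_equality[OF group_GL]) (simp_all add: diag_jet_mult[symmetric] diag_jet_one)
  then show "inv\<^bsub>GL k\<^esub> x \<in> diag_jet k ` (UNIV - {0})" using a(2) by simp
  fix y assume "y \<in> diag_jet k ` (UNIV - {0})"
  then obtain b where "y = diag_jet k b" "b \<noteq> 0" by auto
  with a show "x \<otimes>\<^bsub>GL k\<^esub> y \<in> diag_jet k ` (UNIV - {0})"
    by (auto simp: diag_jet_mult[symmetric])
qed

lemma regular_functions_power: "f \<in> regular_functions n \<Longrightarrow> (\<lambda>A. f A ^ m) \<in> regular_functions n"
  by (induction m) (auto simp: power_Suc intro: regular_functions.intros)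

text \<open>Inside the general linear group the scalings are the diagonal matrices whose entry
  \<open>i\<close> is the power \<open>i + 1\<close> of the first one. The linear coefficient
  identifies them with the multiplicative group.\<close>

lemma torus_diag_jets:
  assumes k: "0 < k"
  shows "torus k (diag_jet k ` (UNIV - {0}))"
proof -
  let ?D = "diag_jet k ` (UNIV - {0})"
  let ?S = "{\<lambda>A. A $$ (i, j) | i j. i < k \<and> j < k \<and> i \<noteq> j} \<union>
    {\<lambda>A. A $$ (i, i) + (- 1) * A $$ (0, 0) ^ Suc i | i. i < k} :: (complex mat \<Rightarrow> complex) set"
  have "(\<lambda>A. A $$ (i, i) + (- 1) * A $$ (0, 0) ^ Suc i) \<in> regular_functions k" if "i < k" for i
    by (intro regular_functions.add regular_functions.mult regular_functions.const
        regular_functions_power regular_functions.entry that k)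
  then have "?S \<subseteq> regular_functions k"
    using regular_functions.entry by blast
  moreover have "?D = {A \<in> carrier (GL k). \<forall>f \<in> ?S. f A = 0}"
  proof (intro equalityI subsetI)
    fix A assume A: "A \<in> ?D"
    then have "A \<in> carrier (GL k)" using subgroup.mem_carrier[OF subgroup_diag_jets] by blast
    moreover have "\<forall>f \<in> ?S. f A = 0"
      using A k by (auto simp: diag_jet_index power_Suc)
    ultimately show "A \<in> {A \<in> carrier (GL k). \<forall>f \<in> ?S. f A = 0}" by blast
  next
    fix A assume A: "A \<in> {A \<in> carrier (GL k). \<forall>f \<in> ?S. f A = 0}"
    then have carr: "A \<in> carrier_mat k k" "det A \<noteq> 0" by (auto simp: carrier_GL_iff)
    have zero: "A $$ (i, j) = 0" if "i < k" "j < k" "i \<noteq> j" for i j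
    proof -
      have "(\<lambda>A. A $$ (i, j)) \<in> ?S" using that by (intro UnI1 CollectI exI[of _ i] exI[of _ j]) simp
      from bspec[OF conjunct2[OF A[unfolded mem_Collect_eq]] this] show ?thesis .
    qed
    have diag: "A $$ (i, i) = A $$ (0, 0) ^ Suc i" if i: "i < k" for i
    proof -
      have "(\<lambda>A. A $$ (i, i) + (- 1) * A $$ (0, 0) ^ Suc i) \<in> ?S" using i by (intro UnI2 CollectI exI[of _ i]) simp
      from bspec[OF conjunct2[OF A[unfolded mem_Collect_eq]] this]
      have "A $$ (i, i) + (- 1) * A $$ (0, 0) ^ Suc i = 0" .
      then show ?thesis by simp
    qed
    have eq: "A = diag_jet k (A $$ (0, 0))"
    proof (rule eq_matI)
      fix i j assume "i < dim_row (diag_jet k (A $$ (0, 0)))" "j < dim_col (diag_jet k (A $$ (0, 0)))"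
      then have ij: "i < k" "j < k" by (simp_all add: diag_jet_def jet_mat_def)
      show "A $$ (i, j) = diag_jet k (A $$ (0, 0)) $$ (i, j)"
        unfolding diag_jet_index[OF ij] using diag[OF ij(1)] zero[OF ij] by auto
    qed (use carr in \<open>simp_all add: diag_jet_def jet_mat_def\<close>)
    have "A $$ (0, 0) \<noteq> 0"
    proof
      assume "A $$ (0, 0) = 0"
      then have "A = jet_mat k (fps_const 0 * fps_X)" using eq unfolding diag_jet_def by metis
      then show False using carr(2) det_jet_mat(2)[of "fps_const 0 * fps_X" k] k by simp
    qed
    with eq show "A \<in> ?D" by blast
  qed
  ultimately have alg: "algebraic_group k ?D"
    unfolding algebraic_group_def by (intro conjI subgroup_diag_jets exI[of _ ?S])
  let ?\<phi> = "\<lambda>A. mat 1 1 (\<lambda>_. jet_character A)"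
  let ?\<psi> = "\<lambda>B :: complex mat. diag_jet k (B $$ (0, 0))"
  have diag1: "B \<in> diagonal_torus 1 \<longleftrightarrow> B \<in> carrier_mat 1 1 \<and> B $$ (0, 0) \<noteq> 0" for B
    by (auto simp: diagonal_torus_def carrier_GL_iff det_single diagonal_mat_def)
  have \<phi>: "?\<phi> \<in> algebraic_hom k ?D 1 (diagonal_torus 1)"
    using k unfolding algebraic_hom_def hom_def
    by (auto simp: diag1 diag1[unfolded One_nat_def] jet_character_diag_jet diag_jet_mult[symmetric] regular_on_jet_character
        scalar_prod_def intro!: eq_matI)
  have \<psi>: "?\<psi> \<in> algebraic_hom 1 (diagonal_torus 1) k ?D"
  proof -
    have "regular_on 1 (diagonal_torus 1) (\<lambda>B. diag_jet k (B $$ (0, 0)) $$ (i, j))"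
      if "i < k" "j < k" for i j
      using that by (cases "i = j")
        (simp_all add: diag_jet_index regular_on_const regular_on_power regular_on_entry)
    moreover have "(B * C) $$ (0, 0) = B $$ (0, 0) * C $$ (0, 0)"
      if "B \<in> carrier_mat 1 1" "C \<in> carrier_mat 1 1" for B C :: "complex mat"
      using that by (simp add: scalar_prod_def)
    ultimately show ?thesis
      unfolding algebraic_hom_def hom_def by (auto simp: diag1[unfolded One_nat_def] diag_jet_mult)
  qed
  have \<psi>\<phi>: "?\<psi> (?\<phi> A) = A" if "A \<in> ?D" for A
    using that k by (auto simp: jet_character_diag_jet)
  have \<phi>\<psi>: "?\<phi> (?\<psi> B) = B" if "B \<in> diagonal_torus 1" for B
    using that k by (auto simp: diag1[unfolded One_nat_def] jet_character_diag_jet intro!: eq_matI)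
  have "algebraic_isomorphic k ?D 1 (diagonal_torus 1)"
    unfolding algebraic_isomorphic_def by (intro bexI[OF _ \<phi>] bexI[OF _ \<psi>] conjI ballI \<psi>\<phi> \<phi>\<psi>)
  with alg show ?thesis unfolding torus_def by (intro conjI exI[of _ 1])
qed

text \<open>The \<open>i\<close>-th coordinate one-parameter subgroup of the diagonal torus.\<close>

definition coord_mat :: "nat \<Rightarrow> nat \<Rightarrow> complex \<Rightarrow> complex mat" where
  "coord_mat r i x = mat r r (\<lambda>(p, q). if p = q then if p = i then x else 1 else 0)"

lemma coord_mat_diagonal_torus:
  assumes "i < r" "x \<noteq> 0"
  shows "coord_mat r i x \<in> diagonal_torus r" and "det (coord_mat r i x) = x"
proof -
  have "det (coord_mat r i x) = (\<Prod>p<r. if p = i then x else 1)"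
    by (subst det_upper_triangular[of _ r])
      (auto simp: coord_mat_def prod_list_diag_prod atLeast0LessThan)
  then show det: "det (coord_mat r i x) = x" using assms(1) by simp
  have "coord_mat r i x \<in> carrier_mat r r" by (simp add: coord_mat_def)
  then show "coord_mat r i x \<in> diagonal_torus r"
    using det assms(2)
    by (auto simp: diagonal_torus_def carrier_GL_iff diagonal_mat_def coord_mat_def)
qed

lemma coord_mat_mult: "coord_mat r i (x * y) = coord_mat r i x * coord_mat r i y"
proof (rule eq_matI)
  fix p q assume "p < dim_row (coord_mat r i x * coord_mat r i y)"
    "q < dim_col (coord_mat r i x * coord_mat r i y)"
  then have pq: "p < r" "q < r" by (simp_all add: coord_mat_def)
  have c: "coord_mat r i z \<in> carrier_mat r r" for z by (simp add: coord_mat_def)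
  have "(coord_mat r i x * coord_mat r i y) $$ (p, q) =
      (\<Sum>l<r. if l = p then coord_mat r i x $$ (p, p) * coord_mat r i y $$ (p, q) else 0)"
    unfolding index_mult_mat_sum[OF c c pq]
    using pq by (intro sum.cong refl) (auto simp: coord_mat_def)
  then show "coord_mat r i (x * y) $$ (p, q) = (coord_mat r i x * coord_mat r i y) $$ (p, q)"
    using pq by (auto simp: coord_mat_def)
qed (simp_all add: coord_mat_def)

lemma coord_mat_one: "coord_mat r i 1 = 1\<^sub>m r"
  by (rule eq_matI) (auto simp: coord_mat_def)

text \<open>Elements of finite order in the kernel of \<open>jet_character\<close> are unipotent, hence trivial.
  So on a torus the character is injective on elements of finite order, which forces
  rank at most one and exponent \<open>1\<close> or \<open>-1\<close>.\<close>

lemma contracted_torus: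
  assumes k: "0 < k" and T: "torus k T" "T \<subseteq> reparam_group k" "T \<noteq> {1\<^sub>m k}"
  obtains \<tau> where "contracted_group k T jet_character \<tau>"
proof -
  obtain r \<phi> \<psi> where \<phi>: "\<phi> \<in> algebraic_hom k T r (diagonal_torus r)"
    and \<psi>: "\<psi> \<in> algebraic_hom r (diagonal_torus r) k T"
    and \<psi>\<phi>: "\<And>A. A \<in> T \<Longrightarrow> \<psi> (\<phi> A) = A" and \<phi>\<psi>: "\<And>B. B \<in> diagonal_torus r \<Longrightarrow> \<phi> (\<psi> B) = B"
    using T(1) unfolding torus_def algebraic_isomorphic_def by blast
  have subT: "subgroup T (GL k)" using T(1) unfolding torus_def algebraic_group_def by blast
  have \<phi>_mem: "\<phi> t \<in> diagonal_torus r" if "t \<in> T" for t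
    using \<phi> that by (auto simp: algebraic_hom_def hom_def)
  have \<psi>_mem: "\<psi> s \<in> T" if "s \<in> diagonal_torus r" for s
    using \<psi> that by (auto simp: algebraic_hom_def hom_def)
  have \<psi>_mult: "\<psi> (s * s') = \<psi> s * \<psi> s'" if "s \<in> diagonal_torus r" "s' \<in> diagonal_torus r" for s s'
    using \<psi> that by (auto simp: algebraic_hom_def hom_def)
  have one_D: "1\<^sub>m r \<in> diagonal_torus r"
    by (auto simp: diagonal_torus_def carrier_GL_iff diagonal_mat_def)
  have \<psi>_one: "\<psi> (1\<^sub>m r) = 1\<^sub>m k"
  proof -
    have "\<psi> (1\<^sub>m r) \<otimes>\<^bsub>GL k\<^esub> \<psi> (1\<^sub>m r) = \<psi> (1\<^sub>m r)"
      using \<psi>_mult[OF one_D one_D] by simp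
    then show ?thesis
      using group.l_cancel_one[OF group_GL, of "\<psi> (1\<^sub>m r)" k "\<psi> (1\<^sub>m r)"]
        subgroup.mem_carrier[OF subT \<psi>_mem[OF one_D]] by simp
  qed
  have mult_D: "s * s' \<in> diagonal_torus r" if "s \<in> diagonal_torus r" "s' \<in> diagonal_torus r" for s s'
  proof -
    have ss: "s \<in> carrier_mat r r" "s' \<in> carrier_mat r r" "det s \<noteq> 0" "det s' \<noteq> 0"
      "diagonal_mat s" "diagonal_mat s'"
      using that by (auto simp: diagonal_torus_def carrier_GL_iff)
    have "diagonal_mat (s * s')"
      unfolding diagonal_mat_def
    proof (intro allI impI)
      fix i j assume "i < dim_row (s * s')" "j < dim_col (s * s')" "i \<noteq> j"
      then have ij: "i < r" "j < r" "i \<noteq> j" using ss by auto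
      show "(s * s') $$ (i, j) = 0"
        unfolding index_mult_mat_sum[OF ss(1,2) ij(1,2)]
        using ss ij by (intro sum.neutral) (auto simp: diagonal_mat_def)
    qed
    then show ?thesis using ss by (auto simp: diagonal_torus_def carrier_GL_iff det_mult)
  qed
  \<comment> \<open>Transported by \<open>\<psi>\<close>, an element of finite order with character
    \<open>1\<close> is a unipotent element of finite order, hence trivial.\<close>
  have torsion: "s = 1\<^sub>m r"
    if s: "s \<in> diagonal_torus r" and N: "0 < N" "s ^\<^sub>m N = 1\<^sub>m r" and \<chi>: "jet_character (\<psi> s) = 1" for s N
  proof -
    have "s ^\<^sub>m M \<in> diagonal_torus r \<and> \<psi> (s ^\<^sub>m M) = \<psi> s ^\<^sub>m M" for M
    proof (induction M)
      case 0
      have "s \<in> carrier_mat r r" "\<psi> s \<in> carrier_mat k k"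
        using s subgroup.mem_carrier[OF subT \<psi>_mem[OF s]]
        by (auto simp: diagonal_torus_def carrier_GL_iff)
      then show ?case using one_D \<psi>_one by simp
    next
      case (Suc M)
      then show ?case using s by (simp add: mult_D \<psi>_mult)
    qed
    from this[of N] have "\<psi> s ^\<^sub>m N = 1\<^sub>m k" using N(2) \<psi>_one by simp
    then have "\<psi> s = 1\<^sub>m k"
      using finite_order_unipotent[OF _ k \<chi> N(1)] \<psi>_mem[OF s] T(2) by blast
    then show ?thesis using \<phi>\<psi>[OF s] \<phi>\<psi>[OF one_D] \<psi>_one by simp
  qed
  define \<gamma> where "\<gamma> i x = \<psi> (coord_mat r i x)" for i x
  have \<gamma>_mem: "\<gamma> i x \<in> T" if "i < r" "x \<noteq> 0" for i x
    unfolding \<gamma>_def by (rule \<psi>_mem[OF coord_mat_diagonal_torus(1)[OF that]])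
  have \<gamma>_mult: "\<gamma> i (x * y) = \<gamma> i x * \<gamma> i y" if "i < r" "x \<noteq> 0" "y \<noteq> 0" for i x y
    unfolding \<gamma>_def coord_mat_mult
    by (rule \<psi>_mult[OF coord_mat_diagonal_torus(1)[OF that(1,2)] coord_mat_diagonal_torus(1)[OF that(1,3)]])
  have \<gamma>_one: "\<gamma> i 1 = 1\<^sub>m k" for i
    by (simp add: \<gamma>_def coord_mat_one \<psi>_one)
  have \<gamma>_laurent: "laurentfun (\<lambda>x. \<gamma> i x $$ (p, q))" if "i < r" "p < k" "q < k" for i p q
  proof -
    have "regular_on r (diagonal_torus r) (\<lambda>s. \<psi> s $$ (p, q))"
      using \<psi> that by (auto simp: algebraic_hom_def)
    then obtain f where f: "f \<in> regular_functions r"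
      "\<And>s. s \<in> diagonal_torus r \<Longrightarrow> \<psi> s $$ (p, q) = f s"
      unfolding regular_on_def by blast
    have "laurentfun (\<lambda>x. f (coord_mat r i x))"
    proof (rule laurentfun_regular[OF f(1)])
      fix p q assume "p < r" "q < r"
      then show "laurentfun (\<lambda>x. coord_mat r i x $$ (p, q))"
        using polyfun_imp_laurentfun[OF polyfun_const] polyfun_imp_laurentfun[OF polyfun_id]
        by (cases "p = q"; cases "p = i") (simp_all add: coord_mat_def)
    next
      show "laurentfun (\<lambda>x. inverse (det (coord_mat r i x)))"
        using coord_mat_diagonal_torus(2)[OF that(1)]
        by (intro laurentfun_cong[OF laurentfun_inverse_power[of 1]]) simp
    qed
    then show ?thesis
      by (rule laurentfun_cong) (simp add: \<gamma>_def f(2) coord_mat_diagonal_torus(1)[OF that(1)])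
  qed
  have inG: "\<gamma> i x \<in> reparam_group k" if "i < r" "x \<noteq> 0" for i x
    using \<gamma>_mem[OF that] T(2) by blast
  have coord_power: "coord_mat r i x ^\<^sub>m N = coord_mat r i (x ^ N)" for i x N
  proof (induction N)
    case 0
    have "coord_mat r i x \<in> carrier_mat r r" by (simp add: coord_mat_def)
    then show ?case by (simp add: coord_mat_one)
  qed (simp add: power_Suc2 coord_mat_mult)
  have exponent: "\<exists>p. \<bar>p\<bar> = 1 \<and> (\<forall>x. x \<noteq> 0 \<longrightarrow> jet_character (\<gamma> i x) = x powi p)" if i: "i < r" for i
  proof -
    have l: "laurentfun (\<lambda>x. jet_character (\<gamma> i x))"
      unfolding jet_character_def by (rule \<gamma>_laurent[OF i k k])
    have one: "jet_character (\<gamma> i 1) = 1"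
      using k by (simp add: \<gamma>_one jet_character_def)
    have mult: "jet_character (\<gamma> i (a * b)) = jet_character (\<gamma> i a) * jet_character (\<gamma> i b)"
      if "a \<noteq> 0" "b \<noteq> 0" for a b
      unfolding \<gamma>_mult[OF i that] by (rule jet_character_mult[OF k inG[OF i that(1)] inG[OF i that(2)]])
    obtain p :: int where p: "\<And>x. x \<noteq> 0 \<Longrightarrow> jet_character (\<gamma> i x) = x powi p"
    proof (rule laurentfun_character[of "\<lambda>x. jet_character (\<gamma> i x)", OF l one mult])
      fix m :: int
      assume m: "\<And>a. a \<noteq> 0 \<Longrightarrow> jet_character (\<gamma> i a) = a powi m"
      show thesis by (rule that[of m]) (rule m)
    qed
    \<comment> \<open>A root of unity in the kernel of \<open>x powi p\<close> yields a torsion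
      element with character \<open>1\<close>.\<close>
    have root: "x = 1" if "x \<noteq> 0" "0 < N" "x ^ N = 1" "x powi p = 1" for x :: complex and N
    proof -
      have "coord_mat r i x = 1\<^sub>m r"
      proof (rule torsion[OF coord_mat_diagonal_torus(1)[OF i that(1)] that(2)])
        show "coord_mat r i x ^\<^sub>m N = 1\<^sub>m r"
          unfolding coord_power that(3) by (rule coord_mat_one)
        show "jet_character (\<psi> (coord_mat r i x)) = 1"
          using p[OF that(1)] that(4) by (simp add: \<gamma>_def)
      qed
      then have "coord_mat r i x $$ (i, i) = 1" using i by simp
      then show ?thesis using i by (simp add: coord_mat_def)
    qed
    have "p \<noteq> 0" using root[of "-1" 2] by auto
    moreover have "\<not> 2 \<le> \<bar>p\<bar>"
    proof
      assume p2: "2 \<le> \<bar>p\<bar>"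
      define N where "N = nat \<bar>p\<bar>"
      \<comment> \<open>A primitive root of unity of order \<open>\<bar>p\<bar>\<close>: it lies in
        the kernel, but its angle is between \<open>0\<close> and \<open>pi\<close>, so it differs
        from \<open>1\<close>.\<close>
      define x where "x = cis (2 * pi / real N)"
      have N: "2 \<le> N" using p2 by (simp add: N_def)
      have "x ^ N = 1" using N by (simp add: x_def DeMoivre)
      moreover have "x powi p = 1"
      proof (cases "0 \<le> p")
        case True
        then show ?thesis using \<open>x ^ N = 1\<close> by (simp add: power_int_def N_def)
      next
        case False
        then show ?thesis using \<open>x ^ N = 1\<close> by (simp add: power_int_def N_def power_inverse)
      qed
      ultimately have "x = 1" using root[of x N] N by (simp add: x_def)
      then have "cos (2 * pi / real N) = 1" by (simp add: x_def complex_eq_iff)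
      moreover have "0 < 2 * pi / real N" "2 * pi / real N \<le> pi"
        using N by (simp_all add: field_simps)
      ultimately show False using cos_monotone_0_pi[of 0 "2 * pi / real N"] by simp
    qed
    ultimately show ?thesis using p by (intro exI[of _ p]) auto
  qed
  have "r \<le> 1"
  proof (rule ccontr)
    assume "\<not> r \<le> 1"
    then have r: "0 < r" "1 < r" by auto
    obtain p q where "\<bar>p\<bar> = 1" "jet_character (\<gamma> 0 (-1)) = (-1) powi p"
      "\<bar>q\<bar> = 1" "jet_character (\<gamma> 1 (-1)) = (-1) powi q"
      using exponent[OF r(1)] exponent[OF r(2)] by (metis neg_equal_0_iff_equal zero_neq_one)
    then have \<chi>: "jet_character (\<gamma> 0 (-1)) = -1" "jet_character (\<gamma> 1 (-1)) = -1"
      by (auto simp: abs_if power_int_minus split: if_splits)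
    \<comment> \<open>An element of order two. As both exponents are odd, its character is
      \<open>(-1) (-1) = 1\<close>, which contradicts \<open>torsion\<close>.\<close>
    define s where "s = coord_mat r 0 (-1) * coord_mat r 1 (-1)"
    note D = coord_mat_diagonal_torus(1)[OF r(1), of "-1"] coord_mat_diagonal_torus(1)[OF r(2), of "-1"]
    have c: "coord_mat r i x \<in> carrier_mat r r" for i x by (simp add: coord_mat_def)
    have entry: "s $$ (i, j) = (if i = j then if i = 0 \<or> i = 1 then -1 else 1 else 0)"
      if "i < r" "j < r" for i j
    proof -
      have "s $$ (i, j) = (\<Sum>l<r. if l = i then coord_mat r 0 (-1) $$ (i, i) * coord_mat r 1 (-1) $$ (i, j) else 0)"
        unfolding s_def index_mult_mat_sum[OF c c that]
        by (intro sum.cong refl) (use that in \<open>auto simp: coord_mat_def\<close>)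
      then show ?thesis using that by (auto simp: coord_mat_def)
    qed
    have sc: "s \<in> carrier_mat r r" unfolding s_def by (rule mult_carrier_mat[OF c c])
    have "s ^\<^sub>m 2 = s * s" using sc by (simp add: numeral_2_eq_2)
    also have "\<dots> = 1\<^sub>m r"
    proof (rule eq_matI)
      fix i j assume "i < dim_row (1\<^sub>m r :: complex mat)" "j < dim_col (1\<^sub>m r :: complex mat)"
      then have ij: "i < r" "j < r" by auto
      have "(s * s) $$ (i, j) = (\<Sum>l<r. if l = i then s $$ (i, i) * s $$ (i, j) else 0)"
        unfolding index_mult_mat_sum[OF sc sc ij]
        using ij by (intro sum.cong refl) (auto simp: entry simp del: index_mult_mat(1))
      then show "(s * s) $$ (i, j) = 1\<^sub>m r $$ (i, j)"
        using ij by (auto simp: entry simp del: index_mult_mat(1))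
    qed (use sc in auto)
    finally have sq: "s ^\<^sub>m 2 = 1\<^sub>m r" .
    have "jet_character (\<psi> s) = jet_character (\<gamma> 0 (-1)) * jet_character (\<gamma> 1 (-1))"
      using \<psi>_mult[OF D] jet_character_mult[OF k inG[OF r(1)] inG[OF r(2)], of "-1" "-1"]
      by (simp add: \<gamma>_def s_def)
    then have "jet_character (\<psi> s) = 1" unfolding \<chi> by simp
    from torsion[OF mult_D[OF D, folded s_def] _ sq this] have "s = 1\<^sub>m r" by simp
    then have "s $$ (0, 0) = 1" using r by simp
    then show False using entry[OF r(1) r(1)] by simp
  qed
  moreover have "r \<noteq> 0"
  proof
    assume "r = 0"
    have "t = 1\<^sub>m k" if "t \<in> T" for t
    proof -
      have "\<phi> t \<in> carrier_mat 0 0"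
        using \<phi>_mem[OF that] \<open>r = 0\<close> by (auto simp: diagonal_torus_def carrier_GL_iff)
      then have "\<phi> t = 1\<^sub>m r" using \<open>r = 0\<close> by (intro eq_matI) auto
      then show ?thesis using \<psi>\<phi>[OF that] \<psi>_one by simp
    qed
    moreover have "1\<^sub>m k \<in> T" using subgroup.one_closed[OF subT] by simp
    ultimately show False using T(3) by blast
  qed
  ultimately have r: "r = 1" by simp
  then obtain p where p: "\<bar>p\<bar> = 1" "\<And>x. x \<noteq> 0 \<Longrightarrow> jet_character (\<gamma> 0 x) = x powi p"
    using exponent[of 0] by auto
  \<comment> \<open>As \<open>p\<close> is \<open>1\<close> or \<open>-1\<close>, the map
    \<open>a \<mapsto> a powi p\<close> is its own inverse; reparametrizing by it makes the
    character of \<open>\<tau> a\<close> equal to \<open>a\<close>.\<close>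
  define \<tau> where "\<tau> a = \<gamma> 0 (a powi p)" for a
  have pp: "(x powi p) powi p = x" for x :: complex
    using p(1) by (auto simp: abs_if power_int_minus split: if_splits)
  have \<tau>_mem: "\<tau> a \<in> T" if "a \<noteq> 0" for a
    unfolding \<tau>_def using that r by (intro \<gamma>_mem) auto
  have \<chi>_\<tau>: "jet_character (\<tau> a) = a" if "a \<noteq> 0" for a
    using p(2)[of "a powi p"] that by (simp add: \<tau>_def pp)
  have \<tau>_mult: "\<tau> (a * b) = \<tau> a * \<tau> b" if "a \<noteq> 0" "b \<noteq> 0" for a b
    unfolding \<tau>_def power_int_mult_distrib using that r by (intro \<gamma>_mult) auto
  \<comment> \<open>In rank one every element of the diagonal torus is a value of
    \<open>coord_mat\<close>, so \<open>\<tau>\<close> covers all of \<open>T\<close>.\<close>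
  have surj: "\<tau> (jet_character t) = t" if t: "t \<in> T" for t
  proof -
    have s: "\<phi> t \<in> carrier_mat 1 1" "det (\<phi> t) \<noteq> 0"
      using \<phi>_mem[OF t] r by (auto simp: diagonal_torus_def carrier_GL_iff)
    define x where "x = \<phi> t $$ (0, 0)"
    have "x \<noteq> 0" using s by (simp add: det_single x_def)
    have "\<phi> t = coord_mat r 0 x"
      using s r by (intro eq_matI) (auto simp: coord_mat_def x_def)
    then have "t = \<gamma> 0 x" using \<psi>\<phi>[OF t] by (simp add: \<gamma>_def)
    then show ?thesis using p(2)[OF \<open>x \<noteq> 0\<close>] by (simp add: \<tau>_def pp)
  qed
  have \<tau>_entry: "laurentfun (\<lambda>a. \<tau> a $$ (i, j))" if "i < k" "j < k" for i j
  proof -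
    have l: "laurentfun (\<lambda>x. \<gamma> 0 x $$ (i, j))" using \<gamma>_laurent[OF _ that] r by simp
    have "p = 1 \<or> p = -1" using p(1) by linarith
    then show ?thesis
      using l laurentfun_inverse_arg[OF l] by (auto simp: \<tau>_def power_int_minus)
  qed
  have "contracted_group k T jet_character \<tau>"
  proof (rule contracted_group.intro)
    show "subgroup T (GL k)" by (rule subT)
    show "regular_on k T jet_character" by (rule regular_on_jet_character[OF k])
    show "regular_on k T (\<lambda>g. inverse (jet_character g))"
      by (rule regular_on_inverse_jet_character[OF k T(2)])
    show "jet_character (g * h) = jet_character g * jet_character h" if "g \<in> T" "h \<in> T" for g h
      using jet_character_mult[OF k] that T(2) by blast
    show "jet_character g \<noteq> 0" if "g \<in> T" for g
      using jet_character_nonzero[OF k] that T(2) by blast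
    show "laurentfun (\<lambda>a. f (\<tau> a))" if "f \<in> regular_functions k" for f
      using \<tau>_mem T(2) by (intro laurentfun_section[OF k that _ \<chi>_\<tau> \<tau>_entry]) auto
    fix g assume g: "g \<in> T"
    note \<chi>g = jet_character_nonzero[OF k subsetD[OF T(2) g]]
    \<comment> \<open>Elements of \<open>T\<close> commute and \<open>g\<close> already equals
      \<open>\<tau>\<close> of its character, so the constant family \<open>g\<close> is a
      contraction.\<close>
    have "g * \<tau> b = \<tau> b * g" if "b \<noteq> 0" for b
      using \<tau>_mult[OF \<chi>g that] \<tau>_mult[OF that \<chi>g] by (simp add: surj[OF g] mult.commute)
    then show "\<exists>M. (\<forall>b. M b \<in> T) \<and> (\<forall>b. b \<noteq> 0 \<longrightarrow> g * \<tau> b = \<tau> b * M b) \<and>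
        M 0 = \<tau> (jet_character g) \<and> (\<forall>f\<in>regular_functions k. polyfun (\<lambda>b. f (M b)))"
      using g surj[OF g] by (intro exI[of _ "\<lambda>_. g"]) (simp add: polyfun_const)
  qed (use \<tau>_mem \<chi>_\<tau> \<tau>_mult in auto)
  then show thesis by (rule that)
qed

text \<open>The trivial group lies in the torus of scalings, so maximality would make that torus
  trivial too, although the scaling by \<open>2\<close> is not the identity.\<close>

lemma maximal_torus_nontrivial:
  assumes k: "0 < k" and T: "maximal_torus k (reparam_group k) T"
  shows "T \<noteq> {1\<^sub>m k}"
proof
  assume "T = {1\<^sub>m k}"
  let ?D = "diag_jet k ` (UNIV - {0})"
  have "1\<^sub>m k \<in> ?D" using diag_jet_one[of k] by (intro image_eqI[of _ _ 1]) auto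
  then have "?D = T"
    using T torus_diag_jets[OF k] diag_jet_mem unfolding maximal_torus_def \<open>T = {1\<^sub>m k}\<close> by blast
  then have "diag_jet k 2 = diag_jet k 1"
    unfolding diag_jet_one \<open>T = {1\<^sub>m k}\<close> by (metis Diff_iff UNIV_I image_eqI singletonD zero_neq_numeral)
  then show False using jet_character_diag_jet[OF k] by (metis one_eq_numeral_iff semiring_norm(85))
qed

section \<open>Restriction to a maximal torus\<close>

text \<open>What the Weyl action demands of a coset: \<open>the_elem\<close> requires a nonempty
  one, and conjugates must stay in \<open>T\<close> because functions on \<open>T\<close> are
  restricted to it.\<close>

lemma normalizer_conj_mem:
  assumes G: "subgroup G (GL n)" and T: "subgroup T (GL n)" "T \<subseteq> G"
    and w: "w \<in> carrier (weyl_group n G T)"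
  shows "w \<noteq> {}"
    and "\<And>a. a \<in> w \<Longrightarrow> a \<in> G"
    and "\<And>a t. a \<in> w \<Longrightarrow> t \<in> T \<Longrightarrow> inv\<^bsub>GL n\<^esub> a * t * a \<in> T"
proof -
  let ?G = "mat_group n G"
  define N where "N = normalizer ?G T"
  interpret G: group ?G by (rule subgroup.subgroup_is_group[OF G group_GL])
  have TG: "subgroup T ?G" using group.subgroup_incl[OF group_GL T(1) G T(2)] .
  have N: "subgroup N ?G"
    unfolding N_def by (rule G.normalizer_imp_subgroup) (use T(2) in simp)
  have "normal T (?G\<lparr>carrier := N\<rparr>)"
    unfolding N_def by (rule G.subgroup_in_normalizer[OF TG])
  then have norm: "normal T (mat_group n N)" by simp
  interpret normal T "mat_group n N" by (rule norm)
  have NG: "N \<subseteq> G" using subgroup.subset[OF N] by simp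
  have TN: "T \<subseteq> N" using subset by simp
  obtain a where a: "a \<in> N" "w = T #>\<^bsub>mat_group n N\<^esub> a"
    using w unfolding weyl_group_def N_def[symmetric] by (auto simp: FactGroup_def RCOSETS_def)
  have wN: "w \<subseteq> N"
    using a r_coset_subset_G[OF subset, of a] by simp
  show "w \<noteq> {}"
    using a rcos_self[OF _ subgroup_axioms, of a] by auto
  show "b \<in> G" if "b \<in> w" for b using that wN NG by blast
  show "inv\<^bsub>GL n\<^esub> b * t * b \<in> T" if "b \<in> w" "t \<in> T" for b t
  proof -
    have "subgroup N (GL n)"
      using group.incl_subgroup[OF group_GL G N] .
    then have "inv\<^bsub>mat_group n N\<^esub> b = inv\<^bsub>GL n\<^esub> b"
      using group.m_inv_consistent[OF group_GL] that(1) wN by blast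
    then show ?thesis using inv_op_closed1[of b t] that wN by auto
  qed
qed

theorem theorem4p9:
  fixes k :: nat and T :: "complex mat set"
  assumes "1 \<le> k"
    and "maximal_torus k (reparam_group k) T"
  shows "character (reparam_group k)
           \<in> Ring.ring_hom (rep_ring k (reparam_group k)) (class_function_ring k (reparam_group k)) \<and>
         inj_on (character (reparam_group k)) (carrier (rep_ring k (reparam_group k))) \<and>
         character T \<in> Ring.ring_hom (rep_ring k T) (class_function_ring k T) \<and>
         inj_on (character T) (carrier (rep_ring k T)) \<and>
         (\<lambda>f. restrict f T)
           \<in> ring_iso (character_ring k (reparam_group k))
                      (weyl_invariant_ring k (reparam_group k) T)"
proof -
  have k: "0 < k" using assms(1) by simp
  let ?G = "reparam_group k"
  have T: "torus k T" "T \<subseteq> ?G" using assms(2) by (auto simp: maximal_torus_def)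
  obtain \<tau> where T': "contracted_group k T jet_character \<tau>"
    using contracted_torus[OF k T maximal_torus_nontrivial[OF k assms(2)]] .
  interpret G: contracted_group k ?G jet_character "diag_jet k"
    by (rule contracted_reparam_group[OF k])
  interpret T: contracted_group k T jet_character \<tau> by (rule T')
  \<comment> \<open>One parameter \<open>c\<close> gives a function on the group and one on the
    torus, and restriction carries the first to the second.\<close>
  define F :: "complex mat set \<Rightarrow> (int \<Rightarrow>\<^sub>0 int) \<Rightarrow> complex mat \<Rightarrow> complex"
    where "F H c = (\<lambda>g\<in>H. frag_eval (\<lambda>m. jet_character g powi m) c)" for H c
  have carr: "carrier (character_ring k ?G) = range (F ?G)" "carrier (character_ring k T) = range (F T)"
    unfolding F_def by (rule G.carrier_character_ring T.carrier_character_ring)+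
  have res: "restrict (F ?G c) T = F T c" for c
    using T(2) by (auto simp: F_def fun_eq_iff)
  \<comment> \<open>The character of a conjugate of \<open>t\<close> by an element of the group is
    the character of \<open>t\<close>, so a function of the character alone is fixed by every
    coset.\<close>
  have weyl: "weyl_action k T w (F T c) = F T c" if w: "w \<in> carrier (weyl_group k ?G T)" for w c
  proof -
    note conj = normalizer_conj_mem[OF G.H T.H T(2) w]
    have "(\<lambda>t\<in>T. F T c (inv\<^bsub>GL k\<^esub> a \<otimes>\<^bsub>GL k\<^esub> t \<otimes>\<^bsub>GL k\<^esub> a)) = F T c" if a: "a \<in> w" for a
    proof (rule ext)
      fix t
      show "(\<lambda>t\<in>T. F T c (inv\<^bsub>GL k\<^esub> a \<otimes>\<^bsub>GL k\<^esub> t \<otimes>\<^bsub>GL k\<^esub> a)) t = F T c t"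
      proof (cases "t \<in> T")
        case True
        have a': "inv\<^bsub>GL k\<^esub> a \<in> ?G" by (rule subgroup.m_inv_closed[OF G.H conj(2)[OF a]])
        have "jet_character (inv\<^bsub>GL k\<^esub> a * t) = jet_character (inv\<^bsub>GL k\<^esub> a) * jet_character t"
          "inv\<^bsub>GL k\<^esub> a * t \<in> ?G"
          using G.\<chi>_mult[OF a'] True T(2) subgroup.m_closed[OF G.H a', of t] by auto
        then have "jet_character (inv\<^bsub>GL k\<^esub> a * t * a) =
            (jet_character (inv\<^bsub>GL k\<^esub> a) * jet_character a) * jet_character t"
          using G.\<chi>_mult[OF _ conj(2)[OF a]] by simp
        also have "jet_character (inv\<^bsub>GL k\<^esub> a) * jet_character a = jet_character (1\<^sub>m k)"
          using G.\<chi>_mult[OF a' conj(2)[OF a]]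
            group.l_inv[OF group_GL subgroup.mem_carrier[OF G.H conj(2)[OF a]]] by simp
        also have "jet_character (1\<^sub>m k) = 1" using k by (simp add: jet_character_def)
        finally show ?thesis using True conj(3)[OF a True] by (simp add: F_def)
      qed (simp add: F_def)
    qed
    then have "(\<lambda>a. \<lambda>t\<in>T. F T c (inv\<^bsub>GL k\<^esub> a \<otimes>\<^bsub>GL k\<^esub> t \<otimes>\<^bsub>GL k\<^esub> a)) ` w = {F T c}"
      using conj(1) by (intro image_eq_singleton)
    then show ?thesis by (simp add: weyl_action_def)
  qed
  have inv: "carrier (weyl_invariant_ring k ?G T) = range (F T)"
    unfolding weyl_invariant_ring_def using weyl by (auto simp: carr)
  have "inj_on (\<lambda>f. restrict f T) (range (F ?G))"
  proof (rule inj_onI)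
    fix f f' assume "f \<in> range (F ?G)" "f' \<in> range (F ?G)" "restrict f T = restrict f' T"
    then obtain c e where ce: "f = F ?G c" "f' = F ?G e" "F T c = F T e"
      by (auto simp: res)
    have "c = e"
    \<comment> \<open>The values on \<open>T\<close> already determine \<open>c\<close>, because the
      character maps \<open>T\<close> onto all nonzero numbers.\<close>
    proof (rule T.weights_unique)
      fix g assume "g \<in> T"
      then show "frag_eval (\<lambda>m. jet_character g powi m) c = frag_eval (\<lambda>m. jet_character g powi m) e"
        using arg_cong[OF ce(3), of "\<lambda>f. f g"] by (simp add: F_def)
    qed
    with ce show "f = f'" by simp
  qed
  then have "bij_betw (\<lambda>f. restrict f T) (carrier (character_ring k ?G))
      (carrier (weyl_invariant_ring k ?G T))"
    unfolding carr inv by (auto simp: bij_betw_def image_image res)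
  moreover have "(\<lambda>f. restrict f T) \<in> Ring.ring_hom (character_ring k ?G) (weyl_invariant_ring k ?G T)"
  proof (rule ring_hom_memI)
    show "restrict f T \<in> carrier (weyl_invariant_ring k ?G T)" if "f \<in> carrier (character_ring k ?G)" for f
      using that unfolding carr inv by (auto simp: res)
  qed (use T(2) in \<open>auto simp: character_ring_def weyl_invariant_ring_def class_function_ring_def fun_eq_iff\<close>)
  ultimately have "(\<lambda>f. restrict f T) \<in> ring_iso (character_ring k ?G) (weyl_invariant_ring k ?G T)"
    unfolding ring_iso_def by blast
  then show ?thesis
    using character_ring_hom[OF G.H] character_ring_hom[OF T.H] G.inj_on_character T.inj_on_character
    by blast
qed

end
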